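(* Let $d\in\mathbb{N}$, $s_0\in(0,1)$, $q>1$ and $c>0$. There exists a constant $C>0$ depending only on $d,s_0,q$ and $c$ such that the following holds. Let $s\in[s_0,1)$, let $\Omega\subset\mathbb{R}^d$ be open, and let $f:[0,\infty)\to[0,\infty)$ be convex, strictly increasing and differentiable with $f(0)=0$, $f(1)=1$ and $t f'(t)\le q f(t)$ for all $t\ge0$. If $u\in G_+(\Omega;q,c,s,f)$, then for any ball $B_R(x_0)\subset\Omega$, any $1/2\le\rho<\tau\le1$ and any $\delta\in(0,1)$, $$f\left(\sup_{B_{\rho R}(x_0)}\frac{u_+}{R^s}\right)\le C\,\frac{\delta^{(1-q)2d/s_0}}{(\tau-\rho)^{\gamma}}\,\frac{1}{|B_{\tau R}(x_0)|}\int_{B_{\tau R}(x_0)}f\left(\frac{u_+(x)}{R^s}\right)dx+\delta f\left(\frac{\mathrm{Tail}_{f'}(u_+;x_0,R/2)}{(R/2)^s}\right),$$ where $\gamma=2d(d+q)/s_0$.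
   Context: $a_\pm=\max\{\pm a,0\}$; $\sup$ of measurable functions is essential. Generalized inverse: $(f')^{-1}(y)=\inf\{t\ge0: f'(t)\ge y\}$ for $y\ge 0$, with $\inf\emptyset=+\infty$, and $f(+\infty)=+\infty$. Tail: $$\mathrm{Tail}_{f'}(u;x_0,R)=R^s (f')^{-1}\left((1-s)R^s\int_{\mathbb{R}^d\setminus B_R(x_0)}f'\left(\frac{|u(y)|}{|y-x_0|^s}\right)\frac{dy}{|y-x_0|^{d+s}}\right).$$ Modulars: $\Phi_{L^f(\Omega)}(u)=\int_\Omega f(|u(x)|)\,dx$, $\Phi_{W^{s,f}(\Omega)}(u)=(1-s)\int_\Omega\int_\Omega f\left(\frac{|u(x)-u(y)|}{|x-y|^s}\right)\frac{dy\,dx}{|x-y|^d}$, $\Phi_{V^{s,f}(\Omega|\mathbb{R}^d)}(u)=(1-s)\iint_{(\Omega^c\times\Omega^c)^c} f\left(\frac{|u(x)-u(y)|}{|x-y|^s}\right)\frac{dy\,dx}{|x-y|^d}$. The space $V^{s,f}(\Omega|\mathbb{R}^d)$ consists of the measurable $u:\mathbb{R}^d\to\mathbb{R}$ with $\Phi_{L^f(\Omega)}(u)<\infty$ and $\Phi_{V^{s,f}(\Omega|\mathbb{R}^d)}(u)<\infty$. De Giorgi class: $u\in G_+(\Omega;q,c,s,f)$ if $u\in V^{s,f}(\Omega|\mathbb{R}^d)$ and for every $x_0\in\Omega$, $0<r<R\le \mathrm{dist}(x_0,\partial\Omega)$ and $k\in\mathbb{R}$, with $w_\pm(x)=(u(x)-k)_\pm$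 and $A_k^-=\{y\in\mathbb{R}^d:u(y)<k\}$, $$\Phi_{W^{s,f}(B_r(x_0))}(w_+)+(1-s)\int_{B_r(x_0)}\int_{A_k^-}f'\left(\frac{w_-(y)}{|x-y|^s}\right)\frac{w_+(x)}{|x-y|^s}\frac{dy\,dx}{|x-y|^d}$$ $$\le c\left(\frac{R}{R-r}\right)^q\Phi_{L^f(B_R(x_0))}\left(\frac{w_+}{R^s}\right)+c\left(\frac{R}{R-r}\right)^{d+sq}\|w_+\|_{L^1(B_R(x_0))}(1-s)\int_{\mathbb{R}^d\setminus B_r(x_0)}f'\left(\frac{w_+(y)}{|y-x_0|^s}\right)\frac{dy}{|y-x_0|^{d+s}}.$$ *)

theory Defs
  imports "HOL-Analysis.Analysis" "HOL-Probability.Essential_Supremum"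
begin

text \<open>A growth function \<open>f : [0,\<infinity>) \<rightarrow> [0,\<infinity>)\<close> is represented by a total function on the reals of which
  only the values on \<open>{0..}\<close> are ever used; \<open>gderiv f\<close> is its derivative on \<open>[0,\<infinity>)\<close>, one-sided at 0.
  All modulars, tails and integrals take values in \<^typ>\<open>ennreal\<close>, so that they may be infinite.
  The kernels are 0 on the diagonal \<open>x = y\<close> because of division by zero; the diagonal is a null set.\<close>

definition gderiv :: "(real \<Rightarrow> real) \<Rightarrow> real \<Rightarrow> real" where
  "gderiv f t = vector_derivative f (at t within {0..})"

definition growth_function :: "real \<Rightarrow> (real \<Rightarrow> real) \<Rightarrow> bool" where
  "growth_function q f \<longleftrightarrow>
     (\<forall>t\<ge>0. f t \<ge> 0) \<and> convex_on {0..} f \<and> strict_mono_on {0..} f \<and>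
     f differentiable_on {0..} \<and> f 0 = 0 \<and> f 1 = 1 \<and>
     (\<forall>t\<ge>0. t * gderiv f t \<le> q * f t)"

definition extend_infinity :: "(real \<Rightarrow> real) \<Rightarrow> ennreal \<Rightarrow> ennreal" where
  "extend_infinity f y = (if y = \<infinity> then \<infinity> else ennreal (f (enn2real y)))"

text \<open>The infimum of the empty set in \<^typ>\<open>ennreal\<close> is \<open>\<infinity>\<close>; in particular the value at \<open>\<infinity>\<close> is \<open>\<infinity>\<close>.\<close>

definition gen_inverse :: "(real \<Rightarrow> real) \<Rightarrow> ennreal \<Rightarrow> ennreal" where
  "gen_inverse g y = Inf {ennreal t |t. t \<ge> 0 \<and> ennreal (g t) \<ge> y}"

definition nonlocal_tail ::
  "real \<Rightarrow> (real \<Rightarrow> real) \<Rightarrow> ('a::euclidean_space \<Rightarrow> real) \<Rightarrow> 'a \<Rightarrow> real \<Rightarrow> ennreal" where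
  "nonlocal_tail s g u x0 R =
     ennreal (R powr s) * gen_inverse g
       (ennreal ((1 - s) * R powr s) *
        (\<integral>\<^sup>+ y \<in> - ball x0 R.
           ennreal (g (\<bar>u y\<bar> / norm (y - x0) powr s) / norm (y - x0) powr (real DIM('a) + s))
         \<partial>lebesgue))"

definition Phi_L :: "(real \<Rightarrow> real) \<Rightarrow> 'a::euclidean_space set \<Rightarrow> ('a \<Rightarrow> real) \<Rightarrow> ennreal" where
  "Phi_L f \<Omega> u = (\<integral>\<^sup>+ x \<in> \<Omega>. ennreal (f \<bar>u x\<bar>) \<partial>lebesgue)"

definition Phi_W ::
  "real \<Rightarrow> (real \<Rightarrow> real) \<Rightarrow> 'a::euclidean_space set \<Rightarrow> ('a \<Rightarrow> real) \<Rightarrow> ennreal" where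
  "Phi_W s f \<Omega> u =
     ennreal (1 - s) *
     (\<integral>\<^sup>+ x \<in> \<Omega>. (\<integral>\<^sup>+ y \<in> \<Omega>.
        ennreal (f (\<bar>u x - u y\<bar> / norm (x - y) powr s) / norm (x - y) ^ DIM('a))
      \<partial>lebesgue) \<partial>lebesgue)"

definition Phi_V ::
  "real \<Rightarrow> (real \<Rightarrow> real) \<Rightarrow> 'a::euclidean_space set \<Rightarrow> ('a \<Rightarrow> real) \<Rightarrow> ennreal" where
  "Phi_V s f \<Omega> u =
     ennreal (1 - s) *
     (\<integral>\<^sup>+ x. (\<integral>\<^sup>+ y.
        ennreal (f (\<bar>u x - u y\<bar> / norm (x - y) powr s) / norm (x - y) ^ DIM('a))
        * indicator (- ((- \<Omega>) \<times> (- \<Omega>))) (x, y)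
      \<partial>lebesgue) \<partial>lebesgue)"

definition V_space ::
  "real \<Rightarrow> (real \<Rightarrow> real) \<Rightarrow> 'a::euclidean_space set \<Rightarrow> ('a \<Rightarrow> real) set" where
  "V_space s f \<Omega> = {u \<in> borel_measurable lebesgue. Phi_L f \<Omega> u < \<infinity> \<and> Phi_V s f \<Omega> u < \<infinity>}"

text \<open>The distance to the boundary is \<open>\<infinity>\<close> if the boundary is empty, i.e. for \<open>\<Omega> = UNIV\<close>
  (\<^const>\<open>infdist\<close> would give 0 in that case).\<close>

definition dist_boundary :: "'a::euclidean_space \<Rightarrow> 'a set \<Rightarrow> ereal" where
  "dist_boundary x \<Omega> = (INF y \<in> frontier \<Omega>. ereal (dist x y))"

definition G_plus ::
  "'a::euclidean_space set \<Rightarrow> real \<Rightarrow> real \<Rightarrow> real \<Rightarrow> (real \<Rightarrow> real) \<Rightarrow> ('a \<Rightarrow> real) set" where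
  "G_plus \<Omega> q c s f =
    {u \<in> V_space s f \<Omega>.
      \<forall>x0\<in>\<Omega>. \<forall>r R k. 0 < r \<longrightarrow> r < R \<longrightarrow> ereal R \<le> dist_boundary x0 \<Omega> \<longrightarrow>
        (let wp = (\<lambda>x. max (u x - k) 0); wm = (\<lambda>x. max (- (u x - k)) 0) in
          Phi_W s f (ball x0 r) wp
          + ennreal (1 - s) *
            (\<integral>\<^sup>+ x \<in> ball x0 r. (\<integral>\<^sup>+ y \<in> {y. u y < k}.
               ennreal (gderiv f (wm y / norm (x - y) powr s) * (wp x / norm (x - y) powr s)
                        / norm (x - y) ^ DIM('a))
             \<partial>lebesgue) \<partial>lebesgue)
          \<le> ennreal (c * (R / (R - r)) powr q)
              * Phi_L f (ball x0 R) (\<lambda>x. wp x / R powr s)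
            + ennreal (c * (R / (R - r)) powr (real DIM('a) + s * q))
              * (\<integral>\<^sup>+ x \<in> ball x0 R. ennreal \<bar>wp x\<bar> \<partial>lebesgue)
              * (ennreal (1 - s) *
                 (\<integral>\<^sup>+ y \<in> - ball x0 r.
                    ennreal (gderiv f (wp y / norm (y - x0) powr s)
                             / norm (y - x0) powr (real DIM('a) + s))
                  \<partial>lebesgue)))}"

end

theory Submission
  imports Defs
begin

text \<open>
  De Giorgi iteration for \<open>a n = \<integral> f ((u - k n)\<^sub>+ / R powr s)\<close> over balls shrinking from radius
  \<open>\<tau> R\<close> to \<open>\<rho> R\<close> and levels increasing from \<open>0\<close> to \<open>\<kappa> R powr s\<close>. No Sobolev
  inequality is needed. Comparing a pair of points with its midpoint shows that the Gagliardo energy of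
  pairs at distance \<open>< 2 H\<close> is at most \<open>2 powr ((1 - s) q)\<close> times the energy of pairs at
  distance \<open>< H\<close>; hence the energy carried by the annulus \<open>H \<le> |x - y| < 2 H\<close> is bounded by
  \<open>1 - s\<close> times the full energy, uniformly as \<open>s \<rightarrow> 1\<close>. If \<open>w \<ge> 0\<close> vanishes on
  half of a ball of radius \<open>H / 2\<close> inside that annulus around each point, the annulus energy controls
  \<open>\<integral> f (w / (2 H) powr s)\<close>. With \<open>H ^ d\<close> comparable to the measure of the superlevel set this
  gives the superlinear gain. In the energy estimate the tail at level \<open>t\<close> is absorbed through
  \<open>f' t \<le> q \<delta> powr (1 - q) f' \<kappa>\<close>, valid as soon as \<open>\<delta> t \<le> \<kappa>\<close>.
\<close>

section \<open>Growth functions: convexity, scaling and the derivative\<close>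

lemma growth_nonneg: "growth_function q f \<Longrightarrow> t \<ge> 0 \<Longrightarrow> f t \<ge> 0"
  by (simp add: growth_function_def)

lemma growth_mono:
  assumes "growth_function q f" "0 \<le> x" "x \<le> y" shows "f x \<le> f y"
proof -
  have "strict_mono_on {0..} f" using assms(1) by (simp add: growth_function_def)
  from strict_mono_onD[OF this, of x y] assms show ?thesis by (cases "x = y") auto
qed

lemma growth_strict_mono:
  assumes "growth_function q f" "0 \<le> x" "x < y" shows "f x < f y"
proof -
  have "strict_mono_on {0..} f" using assms(1) by (simp add: growth_function_def)
  from strict_mono_onD[OF this, of x y] assms show ?thesis by auto
qed

lemma growth_has_derivative:
  assumes "growth_function q f" "0 \<le> x"
  shows "(f has_real_derivative gderiv f x) (at x within {0..})"
proof -
  have "f differentiable (at x within {0..})"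
    using assms by (auto simp: growth_function_def differentiable_on_def)
  then show ?thesis
    unfolding gderiv_def has_real_derivative_iff_has_vector_derivative
    by (rule vector_derivative_works[THEN iffD1])
qed

lemma growth_scale_le:
  assumes g: "growth_function q f" and "0 \<le> l" "l \<le> 1" "0 \<le> t"
  shows "f (l * t) \<le> l * f t"
proof -
  have c: "convex_on {0..} f" and "f 0 = 0" using g by (auto simp: growth_function_def)
  have "f ((1 - l) *\<^sub>R 0 + l *\<^sub>R t) \<le> (1 - l) * f 0 + l * f t"
    by (rule convex_onD[OF c]) (use assms in auto)
  then show ?thesis using \<open>f 0 = 0\<close> by simp
qed

lemma growth_scale_ge:
  assumes g: "growth_function q f" and "1 \<le> l" "0 \<le> t"
  shows "l * f t \<le> f (l * t)"
proof -
  have "f (1 / l * (l * t)) \<le> 1 / l * f (l * t)"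
    by (rule growth_scale_le[OF g]) (use assms in auto)
  then show ?thesis using assms by (simp add: field_simps)
qed

text \<open>Convexity bounds the difference quotients along the segment from \<open>x\<close> to
  \<open>y\<close>, times \<open>y - x\<close>, by \<open>f y - f x\<close>; they tend to the left
  side as the point returns to \<open>x\<close>. The segment stays in \<open>{0..}\<close>, so
  \<open>y\<close> may lie on either side of \<open>x\<close>, and the one-sided derivative at 0 is
  covered.\<close>

lemma growth_tangent:
  assumes g: "growth_function q f" and x: "0 \<le> x" and y: "0 \<le> y"
  shows "gderiv f x * (y - x) \<le> f y - f x"
proof (cases "x = y")
  case False
  have c: "convex_on {0..} f" using g by (auto simp: growth_function_def)
  define p where "p = (\<lambda>l. x + l * (y - x))"
  have p_in: "p l \<in> {0..}" if "0 < l" "l < 1" for l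
  proof -
    have "p l = (1 - l) * x + l * y" by (simp add: p_def algebra_simps)
    then show ?thesis using that x y by simp
  qed
  have lim: "filterlim p (at x within {0..}) (at_right 0)"
    unfolding filterlim_at
  proof (intro conjI)
    show "\<forall>\<^sub>F l in at_right 0. p l \<in> {0..} \<and> p l \<noteq> x"
      unfolding eventually_at_right_field using False p_in
      by (intro exI[of _ 1]) (auto simp: p_def)
    have "(p \<longlongrightarrow> p 0) (at_right 0)"
      unfolding p_def by (intro tendsto_intros)
    then show "(p \<longlongrightarrow> x) (at_right 0)" by (simp add: p_def)
  qed
  have "((\<lambda>z. (f z - f x) / (z - x)) \<longlongrightarrow> gderiv f x) (at x within {0..})"
    using growth_has_derivative[OF g x] by (simp add: has_field_derivative_iff)
  from filterlim_compose[OF this lim]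
  have "((\<lambda>l. (f (p l) - f x) / (p l - x) * (y - x)) \<longlongrightarrow> gderiv f x * (y - x)) (at_right 0)"
    by (intro tendsto_intros)
  moreover have "\<forall>\<^sub>F l in at_right 0. (f (p l) - f x) / (p l - x) * (y - x) \<le> f y - f x"
    unfolding eventually_at_right_field
  proof (intro exI[of _ 1] conjI allI impI)
    fix l :: real assume l: "0 < l" "l < 1"
    have "f ((1 - l) *\<^sub>R x + l *\<^sub>R y) \<le> (1 - l) * f x + l * f y"
      by (rule convex_onD[OF c]) (use l x y in auto)
    moreover have "(1 - l) *\<^sub>R x + l *\<^sub>R y = p l" by (simp add: p_def algebra_simps)
    ultimately have "f (p l) - f x \<le> l * (f y - f x)" by (simp add: algebra_simps)
    then have "(f (p l) - f x) / l \<le> f y - f x" using l by (simp add: field_simps)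
    moreover have "(f (p l) - f x) / (p l - x) * (y - x) = (f (p l) - f x) / l"
      using False l by (simp add: p_def)
    ultimately show "(f (p l) - f x) / (p l - x) * (y - x) \<le> f y - f x" by simp
  qed simp
  ultimately show ?thesis
    by (rule tendsto_upperbound) simp
qed simp

lemma gderiv_mono:
  assumes g: "growth_function q f" and "0 \<le> x" "x \<le> y"
  shows "gderiv f x \<le> gderiv f y"
proof (cases "x = y")
  case False
  have "gderiv f x * (y - x) \<le> gderiv f y * (y - x)"
    using growth_tangent[OF g, of x y] growth_tangent[OF g, of y x] assms
    by (simp add: algebra_simps)
  then show ?thesis using assms False by simp
qed simp

lemma gderiv_nonneg:
  assumes g: "growth_function q f" and "0 \<le> x"
  shows "0 \<le> gderiv f x"
proof -
  have *: "0 \<le> gderiv f 0"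
  proof (rule tendsto_lowerbound)
    show "((\<lambda>z. (f z - f 0) / (z - 0)) \<longlongrightarrow> gderiv f 0) (at 0 within {0..})"
      using growth_has_derivative[OF g, of 0] by (simp add: has_field_derivative_iff)
    show "\<forall>\<^sub>F z in at 0 within {0..}. 0 \<le> (f z - f 0) / (z - 0)"
      unfolding eventually_at_filter using growth_nonneg[OF g] g
      by (auto simp: growth_function_def intro!: always_eventually)
    show "at (0::real) within {0..} \<noteq> bot"
      by (simp add: at_within_Ici_at_right)
  qed
  with gderiv_mono[OF g, of 0 x] assms show ?thesis by simp
qed

text \<open>The tangent at \<open>t\<close>, evaluated at 0. With \<open>gderiv_le\<close> this
  makes \<open>t * gderiv f t\<close> and \<open>f t\<close> comparable.\<close>

lemma growth_le_gderiv:
  assumes g: "growth_function q f" and "0 \<le> t"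
  shows "f t \<le> t * gderiv f t"
  using growth_tangent[OF g, of t 0] assms g by (simp add: growth_function_def algebra_simps)

lemma gderiv_le:
  assumes g: "growth_function q f" and "0 \<le> t"
  shows "t * gderiv f t \<le> q * f t"
  using assms by (simp add: growth_function_def)

text \<open>By \<open>gderiv_le\<close> the function \<open>f x * x powr (-q)\<close> has
  nonpositive derivative for \<open>x > 0\<close>; its values at \<open>t\<close> and
  \<open>l * t\<close> are compared.\<close>

lemma growth_scale_powr:
  assumes g: "growth_function q f" and l: "1 \<le> l" and t: "0 \<le> t"
  shows "f (l * t) \<le> l powr q * f t"
proof (cases "t = 0")
  case True
  then show ?thesis using g by (simp add: growth_function_def)
next
  case False
  with t have t: "t > 0" by simp
  have "f (l * t) * (l * t) powr (-q) \<le> f t * t powr (-q)"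
  proof (rule DERIV_nonpos_imp_nonincreasing[of t "l * t" "\<lambda>x. f x * x powr (-q)"])
    show "t \<le> l * t" using l t by simp
    fix x assume "t \<le> x"
    with t have x: "x > 0" by simp
    have "(f has_real_derivative gderiv f x) (at x)"
      using growth_has_derivative[OF g, of x] x at_within_interior[of x "{0..}"] by simp
    then have "((\<lambda>x. f x * x powr (-q)) has_real_derivative
        (gderiv f x * x powr (-q) + f x * ((-q) * x powr (-q - 1)))) (at x)"
      by (auto intro!: derivative_eq_intros simp: x powr_diff)
    moreover have "gderiv f x * x powr (-q) + f x * ((-q) * x powr (-q - 1))
        = (x * gderiv f x - q * f x) * x powr (-q - 1)"
      using x by (simp add: powr_diff powr_minus field_simps)
    moreover have "(x * gderiv f x - q * f x) * x powr (-q - 1) \<le> 0"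
      using gderiv_le[OF g, of x] x by (intro mult_nonpos_nonneg) auto
    ultimately show "\<exists>y. ((\<lambda>x. f x * x powr (-q)) has_real_derivative y) (at x) \<and> y \<le> 0"
      by force
  qed
  then show ?thesis using l t by (simp add: powr_mult powr_minus field_simps)
qed

lemma growth_continuous_on:
  assumes "growth_function q f" shows "continuous_on {0..} f"
  using assms by (auto simp: growth_function_def intro: differentiable_imp_continuous_on)

lemma growth_measurable:
  assumes g: "growth_function q f" and h: "h \<in> borel_measurable M" and "\<And>x. 0 \<le> h x"
  shows "(\<lambda>x. f (h x)) \<in> borel_measurable M"
proof -
  \<comment> \<open>Monotonicity of \<open>f\<close> is known on \<open>{0..}\<close> only;
    precomposing with \<open>max t 0\<close> makes it monotone, hence Borel, on the whole
    line.\<close>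
  have "mono (\<lambda>t. f (max t 0))"
    by (rule monoI, rule growth_mono[OF g]) auto
  then have "(\<lambda>t. f (max t 0)) \<in> borel_measurable borel" by (rule borel_measurable_mono)
  from measurable_compose[OF h this] show ?thesis using assms(3) by (simp add: max_absorb1)
qed

text \<open>Convexity with \<open>f 0 = 0\<close> and \<open>f 1 = 1\<close> gives
  \<open>f x \<ge> x\<close> for \<open>x \<ge> 1\<close>, so \<open>f\<close> is unbounded and the
  intermediate value theorem applies. This provides levels with a prescribed value of
  \<open>f\<close>.\<close>

lemma growth_surj:
  assumes g: "growth_function q f" and "0 \<le> y"
  obtains x where "0 \<le> x" "f x = y"
proof -
  have "f 0 = 0" "f 1 = 1" using g by (auto simp: growth_function_def)
  moreover have "y \<le> f (max y 1)"
    using growth_scale_ge[OF g, of "max y 1" 1] \<open>f 1 = 1\<close> by simp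
  moreover have "continuous_on {0..max y 1} f"
    using growth_continuous_on[OF g] by (rule continuous_on_subset) auto
  ultimately have "\<exists>x\<ge>0. x \<le> max y 1 \<and> f x = y"
    by (intro IVT') (use assms in auto)
  then show ?thesis using that by blast
qed

text \<open>Monotonicity moves the derivative from \<open>t\<close> to
  \<open>\<kappa> / \<delta>\<close>; there it is compared with \<open>f\<close>, scaled back to
  \<open>\<kappa>\<close>, and compared with the derivative again. Scaling costs
  \<open>\<delta> powr (-q)\<close> and dividing by \<open>\<kappa> / \<delta>\<close> returns one
  factor \<open>\<delta>\<close>. This is the source of the power of \<open>\<delta>\<close> in the
  theorem.\<close>

lemma gderiv_scale:
  assumes g: "growth_function q f" and d: "0 < \<delta>" "\<delta> < 1" and t: "0 \<le> t" "0 < \<kappa>" "\<delta> * t \<le> \<kappa>"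
  shows "gderiv f t \<le> q * \<delta> powr (1 - q) * gderiv f \<kappa>"
proof -
  have q: "q \<ge> 0"
  proof -
    have "0 \<le> 1 * gderiv f 1" using gderiv_nonneg[OF g, of 1] by simp
    also have "\<dots> \<le> q * f 1" by (rule gderiv_le[OF g]) simp
    finally show ?thesis using g by (simp add: growth_function_def)
  qed
  have "gderiv f t \<le> gderiv f (\<kappa> / \<delta>)"
    by (rule gderiv_mono[OF g]) (use d t in \<open>auto simp: field_simps\<close>)
  also have "\<dots> \<le> \<delta> * (q * f (\<kappa> / \<delta>)) / \<kappa>"
    using gderiv_le[OF g, of "\<kappa> / \<delta>"] d t by (simp add: field_simps)
  also have "\<dots> \<le> \<delta> * (q * ((1 / \<delta>) powr q * f \<kappa>)) / \<kappa>"
    using growth_scale_powr[OF g, of "1 / \<delta>" \<kappa>] d t q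
    by (intro divide_right_mono mult_left_mono) (auto simp: field_simps)
  also have "\<dots> = q * \<delta> powr (1 - q) * (f \<kappa> / \<kappa>)"
    using d by (simp add: powr_divide powr_diff)
  also have "\<dots> \<le> q * \<delta> powr (1 - q) * gderiv f \<kappa>"
    using growth_le_gderiv[OF g, of \<kappa>] d t q
    by (intro mult_left_mono) (auto simp: field_simps)
  finally show ?thesis .
qed

section \<open>The Gagliardo energy: midpoint comparison and annuli\<close>

definition gagliardo_kernel :: "real \<Rightarrow> (real \<Rightarrow> real) \<Rightarrow> ('a::euclidean_space \<Rightarrow> real) \<Rightarrow> 'a \<Rightarrow> 'a \<Rightarrow> real" where
  "gagliardo_kernel s f w x y = f (\<bar>w x - w y\<bar> / norm (x - y) powr s) / norm (x - y) ^ DIM('a)"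

lemma gagliardo_kernel_nonneg:
  "growth_function q f \<Longrightarrow> 0 \<le> gagliardo_kernel s f w x y"
  by (simp add: gagliardo_kernel_def growth_nonneg)

lemma gagliardo_kernel_measurable:
  assumes g: "growth_function q f" and w: "w \<in> borel_measurable borel"
  shows "(\<lambda>p. gagliardo_kernel s f w (fst p) (snd p)) \<in> borel_measurable (borel \<Otimes>\<^sub>M borel)"
proof -
  note w[measurable]
  have n[measurable]: "(\<lambda>p::'a \<times> 'a. norm (fst p - snd p)) \<in> borel_measurable (borel \<Otimes>\<^sub>M borel)"
    by measurable
  have [measurable]: "(\<lambda>p. f (\<bar>w (fst p) - w (snd p)\<bar> / norm (fst p - snd p) powr s))
      \<in> borel_measurable (borel \<Otimes>\<^sub>M borel)"
    by (rule growth_measurable[OF g])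
      (auto intro!: borel_measurable_divide powr_real_measurable[OF n] borel_measurable_abs
        borel_measurable_diff measurable_compose[OF measurable_fst w] measurable_compose[OF measurable_snd w])
  show ?thesis unfolding gagliardo_kernel_def
    by (intro borel_measurable_divide borel_measurable_power) measurable
qed

text \<open>The increment from \<open>x\<close> to \<open>z\<close> is split at the midpoint, where
  the distances halve. This leaves \<open>2 powr (1 - s)\<close> times the mean of the two
  quotients, hence \<open>2 powr ((1 - s) * q)\<close> by growth scaling, and convexity splits the
  mean. The denominator collects \<open>2 ^ d\<close> from the kernel and 2 from the mean.\<close>

lemma gagliardo_kernel_midpoint:
  fixes w :: "'a::euclidean_space \<Rightarrow> real"
  assumes g: "growth_function q f" and s: "s \<le> 1"
  defines "m \<equiv> \<lambda>x z. (1/2) *\<^sub>R (x + z)"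
  shows "gagliardo_kernel s f w x z \<le> 2 powr ((1 - s) * q) / 2 ^ (DIM('a) + 1) *
    (gagliardo_kernel s f w x (m x z) + gagliardo_kernel s f w z (m x z))"
proof (cases "x = z")
  case True
  then have "gagliardo_kernel s f w x z = 0" by (simp add: gagliardo_kernel_def)
  then show ?thesis using gagliardo_kernel_nonneg[OF g]
    by (auto intro!: divide_nonneg_nonneg mult_nonneg_nonneg add_nonneg_nonneg)
next
  case False
  define t where "t = norm (x - z) / 2"
  have t: "t > 0" using False by (simp add: t_def)
  have "x - m x z = (1/2) *\<^sub>R (x - z)" "z - m x z = - ((1/2) *\<^sub>R (x - z))"
    by (simp_all add: m_def algebra_simps flip: scaleR_add_left)
  then have n: "norm (x - m x z) = t" "norm (z - m x z) = t" "norm (x - z) = 2 * t"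
    by (simp_all add: t_def)
  define a where "a = \<bar>w x - w (m x z)\<bar> / t powr s"
  define b where "b = \<bar>w z - w (m x z)\<bar> / t powr s"
  have ab: "a \<ge> 0" "b \<ge> 0" by (auto simp: a_def b_def)
  have c: "convex_on {0..} f" using g by (auto simp: growth_function_def)
  have "\<bar>w x - w z\<bar> / norm (x - z) powr s \<le> (\<bar>w x - w (m x z)\<bar> + \<bar>w z - w (m x z)\<bar>) / (2 * t) powr s"
    unfolding n by (intro divide_right_mono) auto
  also have "\<dots> = 2 powr (1 - s) * ((a + b) / 2)"
    using t by (simp add: a_def b_def powr_mult powr_diff add_divide_distrib mult.commute)
  finally have "f (\<bar>w x - w z\<bar> / norm (x - z) powr s) \<le> f (2 powr (1 - s) * ((a + b) / 2))"
    by (rule growth_mono[OF g, rotated]) simp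
  also have "\<dots> \<le> (2 powr (1 - s)) powr q * f ((a + b) / 2)"
    by (rule growth_scale_powr[OF g]) (use ab s in \<open>auto simp: ge_one_powr_ge_zero\<close>)
  also have "f ((a + b) / 2) \<le> f a / 2 + f b / 2"
    using convex_onD[OF c, of "1/2" a b] ab by (simp add: add_divide_distrib)
  finally have "f (\<bar>w x - w z\<bar> / norm (x - z) powr s) \<le> 2 powr ((1 - s) * q) * (f a / 2 + f b / 2)"
    by (simp add: powr_powr)
  then have "f (\<bar>w x - w z\<bar> / norm (x - z) powr s) / norm (x - z) ^ DIM('a)
      \<le> 2 powr ((1 - s) * q) * (f a / 2 + f b / 2) / norm (x - z) ^ DIM('a)"
    by (intro divide_right_mono) auto
  also have "\<dots> = 2 powr ((1 - s) * q) / 2 ^ (DIM('a) + 1) * (f a / t ^ DIM('a) + f b / t ^ DIM('a))"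
    using t by (simp add: n power_mult_distrib field_simps)
  finally show ?thesis
    by (simp add: gagliardo_kernel_def n a_def b_def)
qed

text \<open>Substitution of the midpoint at fixed \<open>x\<close>: a homothety of ratio 1/2, with
  Jacobian \<open>(1/2) ^ d\<close>.\<close>

lemma nn_integral_midpoint:
  fixes h :: "'a::euclidean_space \<Rightarrow> ennreal"
  assumes [measurable]: "h \<in> borel_measurable borel"
  shows "(\<integral>\<^sup>+z. h ((1/2) *\<^sub>R (x + z)) \<partial>lborel) = 2 ^ DIM('a) * (\<integral>\<^sup>+m. h m \<partial>lborel)"
proof -
  let ?T = "\<lambda>z::'a. (1/2) *\<^sub>R x + (1/2) *\<^sub>R z"
  have "(\<integral>\<^sup>+m. h m \<partial>lborel) = (\<integral>\<^sup>+m. h m \<partial>density (distr lborel borel ?T) (\<lambda>_. ennreal (\<bar>1/2\<bar>^DIM('a))))"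
    by (rule arg_cong[where f = "\<lambda>N. nn_integral N h"], rule lborel_affine) simp
  also have "\<dots> = ennreal ((1/2)^DIM('a)) * (\<integral>\<^sup>+z. h (?T z) \<partial>lborel)"
    by (simp add: nn_integral_density nn_integral_distr nn_integral_cmult)
  finally have "2 ^ DIM('a) * (\<integral>\<^sup>+m. h m \<partial>lborel)
     = (ennreal (2 ^ DIM('a)) * ennreal ((1/2)^DIM('a))) * (\<integral>\<^sup>+z. h (?T z) \<partial>lborel)"
    by (simp add: mult.assoc flip: ennreal_power)
  also have "ennreal (2 ^ DIM('a)) * ennreal ((1/2)^DIM('a)) = 1"
    by (simp flip: ennreal_mult power_mult_distrib)
  finally show ?thesis by (simp add: scaleR_add_right)
qed

text \<open>The midpoint inequality is integrated. Convexity keeps the midpoint in \<open>S\<close>,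
  and both half pairs have distance less than \<open>H\<close>. Each half-pair integral equals
  \<open>2 ^ d * J (D H)\<close>, so their sum cancels \<open>2 ^ (d + 1)\<close>. The remaining
  constant tends to 1 as s tends to 1, which makes differences of energies small.\<close>

lemma gagliardo_doubling:
  fixes w :: "'a::euclidean_space \<Rightarrow> real" and S :: "'a set"
  assumes g: "growth_function q f" and s: "s \<le> 1"
    and w: "w \<in> borel_measurable borel" and S: "convex S" and Sm: "S \<in> sets borel"
  defines "D \<equiv> \<lambda>H. {(x, y). x \<in> S \<and> y \<in> S \<and> norm (x - y) < H}"
  defines "J \<equiv> \<lambda>T. \<integral>\<^sup>+x. \<integral>\<^sup>+y. ennreal (gagliardo_kernel s f w x y) * indicator T (x, y) \<partial>lborel \<partial>lborel"
  shows "J (D (2 * H)) \<le> ennreal (2 powr ((1 - s) * q)) * J (D H)"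
proof -
  define G where "G = (\<lambda>x y. ennreal (gagliardo_kernel s f w x y) * indicator (D H) (x, y))"
  define m where "m = (\<lambda>x z::'a. (1/2) *\<^sub>R (x + z))"
  define l where "l = 2 powr ((1 - s) * q)"
  note gagliardo_kernel_measurable[OF g w, measurable] Sm[measurable]
  have [measurable]: "D H \<in> sets (borel \<Otimes>\<^sub>M borel)" 
  proof -
    have "D H = {p \<in> space (borel \<Otimes>\<^sub>M borel). fst p \<in> S \<and> snd p \<in> S \<and> norm (fst p - snd p) < H}"
      by (auto simp: D_def space_pair_measure)
    then show ?thesis by simp
  qed
  have Gm: "(\<lambda>p. G (fst p) (snd p)) \<in> borel_measurable (borel \<Otimes>\<^sub>M borel)"
    unfolding G_def by measurable
  have [measurable]: "(\<lambda>x. G (a x) (b x)) \<in> borel_measurable N"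
    if "a \<in> measurable N borel" "b \<in> measurable N borel" for a b and N :: "'b measure"
    using measurable_compose[OF measurable_Pair[OF that] Gm] by simp
  have JG: "J (D H) = (\<integral>\<^sup>+x. \<integral>\<^sup>+y. G x y \<partial>lborel \<partial>lborel)"
    by (simp add: J_def G_def)
  have pt: "ennreal (gagliardo_kernel s f w x z) * indicator (D (2 * H)) (x, z)
      \<le> ennreal (l / 2 ^ (DIM('a) + 1)) * (G x (m x z) + G z (m x z))" for x z
  proof (cases "(x, z) \<in> D (2 * H)")
    case True
    then have "x \<in> S" "z \<in> S" and n: "norm (x - z) < 2 * H" by (auto simp: D_def)
    then have "m x z \<in> S"
      using convexD_alt[OF S, of x z "1/2"] by (simp add: m_def scaleR_add_right)
    have "x - m x z = (1/2) *\<^sub>R (x - z)" "z - m x z = - ((1/2) *\<^sub>R (x - z))"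
      by (simp_all add: m_def algebra_simps flip: scaleR_add_left)
    with n \<open>x \<in> S\<close> \<open>z \<in> S\<close> \<open>m x z \<in> S\<close> have "(x, m x z) \<in> D H" "(z, m x z) \<in> D H"
      by (auto simp: D_def)
    with True gagliardo_kernel_midpoint[OF g s, of w x z] show ?thesis
      by (simp add: G_def l_def m_def gagliardo_kernel_nonneg[OF g] add_nonneg_nonneg
        flip: ennreal_mult' ennreal_plus)
  qed simp
  have "J (D (2 * H)) \<le> (\<integral>\<^sup>+x. \<integral>\<^sup>+z. ennreal (l / 2 ^ (DIM('a) + 1)) * (G x (m x z) + G z (m x z)) \<partial>lborel \<partial>lborel)"
    unfolding J_def by (intro nn_integral_mono pt)
  also have "\<dots> = ennreal (l / 2 ^ (DIM('a) + 1)) *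
      ((\<integral>\<^sup>+x. \<integral>\<^sup>+z. G x (m x z) \<partial>lborel \<partial>lborel) + (\<integral>\<^sup>+x. \<integral>\<^sup>+z. G z (m x z) \<partial>lborel \<partial>lborel))"
    unfolding m_def by (subst nn_integral_cmult nn_integral_add; measurable)+
  \<comment> \<open>Exchanging the order of integration turns the pairs \<open>(z, m)\<close> into
    pairs \<open>(x, m)\<close>, since the midpoint is symmetric.\<close>
  also have "(\<integral>\<^sup>+x. \<integral>\<^sup>+z. G z (m x z) \<partial>lborel \<partial>lborel) = (\<integral>\<^sup>+z. \<integral>\<^sup>+x. G z (m x z) \<partial>lborel \<partial>lborel)"
    unfolding m_def by (rule lborel_pair.Fubini'[symmetric]) (simp add: split_beta', measurable)
  also have "\<dots> = (\<integral>\<^sup>+x. \<integral>\<^sup>+z. G x (m x z) \<partial>lborel \<partial>lborel)"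
    by (simp add: m_def add.commute)
  also have "\<dots> = 2 ^ DIM('a) * J (D H)"
    unfolding m_def JG by (subst nn_integral_midpoint; (subst nn_integral_cmult)?; measurable)
  also have "ennreal (l / 2 ^ (DIM('a) + 1)) * (2 ^ DIM('a) * J (D H) + 2 ^ DIM('a) * J (D H))
     = ennreal (l / 2 ^ (DIM('a) + 1)) * ennreal (2 ^ (DIM('a) + 1)) * J (D H)"
    by (simp add: ennreal_mult mult.assoc flip: ennreal_power mult_2)
  also have "ennreal (l / 2 ^ (DIM('a) + 1)) * ennreal (2 ^ (DIM('a) + 1)) = ennreal l"
    by (simp add: l_def flip: ennreal_mult)
  finally show ?thesis by (simp add: l_def)
qed

text \<open>Nonnegative integrals against a measure and its completion agree for every function, so
  the energy can be handled in \<open>lborel\<close>, where product measurability is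
  available.\<close>

lemma Phi_W_eq_lborel:
  "Phi_W s f S w = ennreal (1 - s) *
    (\<integral>\<^sup>+x. \<integral>\<^sup>+y. ennreal (gagliardo_kernel s f w x y) * indicator (S \<times> S) (x, y) \<partial>lborel \<partial>lborel)"
  unfolding Phi_W_def nn_integral_completion
proof (intro arg_cong2[where f = times] nn_integral_cong refl)
  fix x
  show "(\<integral>\<^sup>+y\<in>S. ennreal (f (\<bar>w x - w y\<bar> / norm (x - y) powr s) / norm (x - y) ^ DIM('a)) \<partial>lborel) * indicator S x
    = (\<integral>\<^sup>+y. ennreal (gagliardo_kernel s f w x y) * indicator (S \<times> S) (x, y) \<partial>lborel)"
    by (cases "x \<in> S") (simp_all add: gagliardo_kernel_def indicator_times)
qed

text \<open>Convexity of \<open>exp\<close> between 0 and \<open>q * ln 2\<close>. With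
  \<open>t = 1 - s\<close> it turns the excess of the doubling constant over 1 into the normalising
  factor of \<open>Phi_W\<close>.\<close>

lemma two_powr_minus_one_le:
  fixes q t :: real
  assumes "0 \<le> t" "t \<le> 1"
  shows "2 powr (t * q) - 1 \<le> t * 2 powr q"
proof -
  have "convex_on UNIV (exp :: real \<Rightarrow> real)" by (rule exp_convex)
  from convex_onD[OF this, of t 0 "q * ln 2"] assms
  have "2 powr (t * q) \<le> (1 - t) + t * 2 powr q" by (simp add: powr_def mult_ac)
  then show ?thesis using assms by simp
qed

text \<open>The annulus is \<open>D (2 * H) - D H\<close>, so doubling bounds its energy by
  \<open>(l - 1) * J (D H)\<close> with \<open>l - 1 \<le> (1 - s) * 2 powr q\<close>. The factor
  \<open>1 - s\<close> is exactly the one in \<open>Phi_W\<close>, so the bound does not degenerate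
  as s tends to 1.\<close>

lemma annulus_le_Phi_W:
  fixes w :: "'a::euclidean_space \<Rightarrow> real" and S :: "'a set"
  assumes g: "growth_function q f" and s: "0 < s" "s < 1"
    and w: "w \<in> borel_measurable borel" and S: "convex S" and Sm: "S \<in> sets borel"
  shows "(\<integral>\<^sup>+x. \<integral>\<^sup>+y. ennreal (gagliardo_kernel s f w x y) *
      indicator {(x, y). x \<in> S \<and> y \<in> S \<and> H \<le> norm (x - y) \<and> norm (x - y) < 2 * H} (x, y) \<partial>lborel \<partial>lborel)
    \<le> ennreal (2 powr q) * Phi_W s f S w"
proof (cases "H > 0")
  case H: True
  define D where "D = (\<lambda>H. {(x, y). x \<in> S \<and> y \<in> S \<and> norm (x - y) < H})"
  define N where "N = {(x, y). x \<in> S \<and> y \<in> S \<and> H \<le> norm (x - y) \<and> norm (x - y) < 2 * H}"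
  define J where "J = (\<lambda>T. \<integral>\<^sup>+x. \<integral>\<^sup>+y. ennreal (gagliardo_kernel s f w x y) * indicator T (x, y) \<partial>lborel \<partial>lborel)"
  define l where "l = 2 powr ((1 - s) * q)"
  note gagliardo_kernel_measurable[OF g w, measurable] Sm[measurable]
  have Dm[measurable]: "D H \<in> sets (borel \<Otimes>\<^sub>M borel)" for H
  proof -
    have "D H = {p \<in> space (borel \<Otimes>\<^sub>M borel). fst p \<in> S \<and> snd p \<in> S \<and> norm (fst p - snd p) < H}"
      by (auto simp: D_def space_pair_measure)
    then show ?thesis by simp
  qed
  have N: "N = D (2 * H) - D H" by (auto simp: N_def D_def)
  have Nm[measurable]: "N \<in> sets (borel \<Otimes>\<^sub>M borel)" unfolding N by measurable
  have km: "(\<lambda>p. ennreal (gagliardo_kernel s f w (fst p) (snd p)) * indicator T p) \<in> borel_measurable (lborel \<Otimes>\<^sub>M lborel)"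
    if [measurable]: "T \<in> sets (borel \<Otimes>\<^sub>M borel)" for T
    by measurable
  have kx: "(\<lambda>y. ennreal (gagliardo_kernel s f w x y) * indicator T (x, y)) \<in> borel_measurable lborel"
    if "T \<in> sets (borel \<Otimes>\<^sub>M borel)" for T x
    using measurable_compose[OF measurable_Pair1' km[OF that], of x] by simp
  have kI: "(\<lambda>x. \<integral>\<^sup>+y. ennreal (gagliardo_kernel s f w x y) * indicator T (x, y) \<partial>lborel) \<in> borel_measurable lborel"
    if "T \<in> sets (borel \<Otimes>\<^sub>M borel)" for T
    using lborel.borel_measurable_nn_integral[of "\<lambda>x y. ennreal (gagliardo_kernel s f w x y) * indicator T (x, y)"]
      km[OF that] by (simp add: split_beta')
  have mono: "J T \<le> J T'" if "T \<subseteq> T'" for T T'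
    unfolding J_def using that
    by (intro nn_integral_mono mult_left_mono) (auto simp: indicator_def)
  have "J (D H) + J N = J (D (2 * H))"
  proof -
    have "indicator (D (2*H)) p = (indicator (D H) p + indicator N p :: ennreal)" for p
      using H by (cases p) (auto simp: D_def N_def indicator_def)
    then show ?thesis unfolding J_def
      by (simp add: distrib_left nn_integral_add[OF kx[OF Dm] kx[OF Nm]]
        nn_integral_add[OF kI[OF Dm] kI[OF Nm]])
  qed
  also have "\<dots> \<le> ennreal l * J (D H)"
    unfolding J_def D_def l_def
    using gagliardo_doubling[OF g _ w S Sm, of s H] s by simp
  finally have le: "J (D H) + J N \<le> ennreal l * J (D H)" .
  have P: "ennreal (1 - s) * J (D H) \<le> Phi_W s f S w"
  proof -
    have "Phi_W s f S w = ennreal (1 - s) * J (S \<times> S)" by (simp add: Phi_W_eq_lborel J_def)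
    moreover have "J (D H) \<le> J (S \<times> S)" by (rule mono) (auto simp: D_def)
    ultimately show ?thesis by (simp add: mult_left_mono)
  qed
  show ?thesis
  \<comment> \<open>\<open>J (D H)\<close> may be subtracted when it is finite; if it is infinite,
    so is \<open>Phi_W\<close>, because \<open>1 - s > 0\<close>.\<close>
  proof (cases "J (D H)")
    case (real a)
    have "J N < \<infinity>"
      using le real by (auto simp: top_unique ennreal_mult_eq_top_iff less_top[symmetric] ennreal_add_eq_top)
    then obtain b where b: "J N = ennreal b" "b \<ge> 0" by (cases "J N") auto
    have "a + b \<le> l * a"
      using le real b by (simp add: l_def flip: ennreal_mult ennreal_plus)
    then have "b \<le> (l - 1) * a" by (simp add: algebra_simps)
    also have "\<dots> \<le> ((1 - s) * 2 powr q) * a"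
      using two_powr_minus_one_le[of "1 - s" q] s real unfolding l_def by (intro mult_right_mono) auto
    finally have "J N \<le> ennreal (2 powr q) * (ennreal (1 - s) * J (D H))"
      using s b real by (simp flip: ennreal_mult' add: mult_ac)
    also have "\<dots> \<le> ennreal (2 powr q) * Phi_W s f S w"
      by (intro mult_left_mono P) simp
    finally show ?thesis by (simp add: J_def N_def)
  next
    case top
    then have "Phi_W s f S w = \<infinity>"
      using P s by (simp add: ennreal_mult_top top_unique)
    then show ?thesis by (simp add: ennreal_mult_top)
  qed
next
  case False
  then have e: "{(x, y). x \<in> S \<and> y \<in> S \<and> H \<le> norm (x - y) \<and> norm (x - y) < 2 * H} = {}"
    using norm_ge_zero by (auto simp: not_less)
  show ?thesis unfolding e by simp
qed

section \<open>A Faber-Krahn inequality for small supports\<close>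

text \<open>The centre \<open>p\<close> lies at distance \<open>3/2 * H\<close> from
  \<open>x\<close> in the direction of \<open>x0\<close>, or in any direction if
  \<open>x = x0\<close>. Then \<open>norm (x0 - p) + H / 2\<close> equals
  \<open>norm (x0 - x) - H\<close> or \<open>2 * H - norm (x0 - x)\<close>, and both are at most
  \<open>r\<close>.\<close>

lemma ball_annulus_contains_ball:
  fixes x0 :: "'a::euclidean_space"
  assumes H: "0 < H" "2 * H \<le> r" and x: "x \<in> ball x0 r"
  obtains p where "ball p (H / 2) \<subseteq> ball x0 r"
    "\<And>y. y \<in> ball p (H / 2) \<Longrightarrow> H \<le> norm (x - y) \<and> norm (x - y) < 2 * H"
proof -
  obtain e :: 'a where e: "norm e = 1" "x0 - x = norm (x0 - x) *\<^sub>R e"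
  proof (cases "x = x0")
    case True
    then show ?thesis using that[of "SOME b. b \<in> Basis"] by (simp add: SOME_Basis)
  next
    case False
    then show ?thesis using that[of "(x0 - x) /\<^sub>R norm (x0 - x)"] by simp
  qed
  define p where "p = x + (3/2 * H) *\<^sub>R e"
  have "x0 - p = (norm (x0 - x) - 3/2 * H) *\<^sub>R e"
    using e(2) by (simp add: p_def algebra_simps)
  then have n: "norm (x0 - p) = \<bar>norm (x0 - x) - 3/2 * H\<bar>" using e(1) by simp
  have xp: "norm (x - p) = 3/2 * H" using e(1) H by (simp add: p_def)
  show ?thesis
  proof
    show "ball p (H / 2) \<subseteq> ball x0 r"
    proof
      fix y assume "y \<in> ball p (H / 2)"
      then have "norm (p - y) < H / 2" by (simp add: dist_norm)
      moreover have "norm (x0 - y) \<le> norm (x0 - p) + norm (p - y)"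
        using norm_triangle_ineq[of "x0 - p" "p - y"] by simp
      ultimately have "norm (x0 - y) < r"
        using n x H norm_ge_zero[of "x0 - x"] by (simp only: mem_ball dist_norm)
      then show "y \<in> ball x0 r" by (simp add: dist_norm)
    qed
    fix y assume "y \<in> ball p (H / 2)"
    then have "norm (p - y) < H / 2" by (simp add: dist_norm)
    then show "H \<le> norm (x - y) \<and> norm (x - y) < 2 * H"
      using xp norm_triangle_ineq[of "x - p" "p - y"] norm_diff_ineq[of "x - p" "p - y"] by auto
  qed
qed

text \<open>Around each \<open>x\<close> with \<open>w x > 0\<close> the annulus contains a ball of
  radius \<open>H / 2\<close>, and \<open>w\<close> vanishes on a part \<open>T\<close> of at least
  half its measure. For \<open>y\<close> in \<open>T\<close> the kernel is at least
  \<open>f (w x / (2 * H) powr s) / (2 * H) ^ d\<close>, so the energy of the annulus at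
  \<open>x\<close> controls the integrand on the left.\<close>

lemma Faber_Krahn_borel:
  fixes w :: "'a::euclidean_space \<Rightarrow> real"
  assumes g: "growth_function q f" and s: "0 < s" "s < 1"
    and w: "w \<in> borel_measurable borel" and wnn: "\<And>x. w x \<ge> 0"
    and H: "0 < H" "2 * H \<le> r"
    and A: "emeasure lborel {x \<in> ball x0 r. w x > 0} \<le> ennreal (unit_ball_vol (DIM('a)) * (H / 2) ^ DIM('a) / 2)"
  shows "(\<integral>\<^sup>+x\<in>ball x0 r. ennreal (f (w x / (2 * H) powr s)) \<partial>lborel)
    \<le> ennreal (2 * 4 ^ DIM('a) * 2 powr q / unit_ball_vol (DIM('a))) * Phi_W s f (ball x0 r) w"
proof -
  let ?B = "ball x0 r" and ?d = "DIM('a)"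
  define \<omega> where "\<omega> = unit_ball_vol (real ?d)"
  have \<omega>: "\<omega> > 0" by (simp add: \<omega>_def)
  define N where "N = {(x, y). x \<in> ?B \<and> y \<in> ?B \<and> H \<le> norm (x - y) \<and> norm (x - y) < 2 * H}"
  define I where "I = (\<lambda>x. \<integral>\<^sup>+y. ennreal (gagliardo_kernel s f w x y) * indicator N (x, y) \<partial>lborel)"
  note gagliardo_kernel_measurable[OF g w, measurable] w[measurable]
  have Am: "{x \<in> ?B. w x > 0} \<in> sets lborel" by measurable
  have [measurable]: "N \<in> sets (borel \<Otimes>\<^sub>M borel)"
  proof -
    have "N = {p \<in> space (borel \<Otimes>\<^sub>M borel). fst p \<in> ?B \<and> snd p \<in> ?B \<and>
        H \<le> norm (fst p - snd p) \<and> norm (fst p - snd p) < 2 * H}"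
      by (auto simp: N_def space_pair_measure)
    then show ?thesis by simp
  qed
  have "(\<lambda>p. ennreal (gagliardo_kernel s f w (fst p) (snd p)) * indicator N p) \<in> borel_measurable (lborel \<Otimes>\<^sub>M lborel)"
    by measurable
  then have Im: "I \<in> borel_measurable lborel"
    unfolding I_def
    using lborel.borel_measurable_nn_integral[of "\<lambda>x y. ennreal (gagliardo_kernel s f w x y) * indicator N (x, y)"]
    by (simp add: split_beta')
  have pt: "ennreal (f (w x / (2 * H) powr s)) * indicator ?B x \<le> ennreal (2 * 4 ^ ?d / \<omega>) * I x" for x
  proof (cases "x \<in> ?B \<and> w x > 0")
    case True
    then have x: "x \<in> ?B" and wx: "w x > 0" by auto
    obtain p where p: "ball p (H / 2) \<subseteq> ?B"
      "\<And>y. y \<in> ball p (H / 2) \<Longrightarrow> H \<le> norm (x - y) \<and> norm (x - y) < 2 * H"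
      using ball_annulus_contains_ball[OF H x] by blast
    define T where "T = ball p (H / 2) - {x \<in> ?B. w x > 0}"
    have [measurable]: "T \<in> sets borel" unfolding T_def using Am by simp
    define F where "F = f (w x / (2 * H) powr s)"
    have F: "F \<ge> 0" unfolding F_def by (intro growth_nonneg[OF g]) (use wx in auto)
    have "ennreal (\<omega> * (H / 2) ^ ?d / 2) \<le> emeasure lborel T"
    proof -
      have b: "emeasure lborel (ball p (H / 2)) = ennreal (\<omega> * (H / 2) ^ ?d)"
        using emeasure_ball[of "H / 2" p] H by (simp add: \<omega>_def)
      \<comment> \<open>Two equal finite halves, so that one of them can be cancelled in
        \<open>ennreal\<close> against the bound for the positivity set.\<close>
      also have "\<dots> = ennreal (\<omega> * (H / 2) ^ ?d / 2) + ennreal (\<omega> * (H / 2) ^ ?d / 2)"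
        using H \<omega> by (simp flip: ennreal_plus)
      finally have "ennreal (\<omega> * (H / 2) ^ ?d / 2) + ennreal (\<omega> * (H / 2) ^ ?d / 2)
          = emeasure lborel (ball p (H / 2))" by simp
      also have "\<dots> \<le> emeasure lborel (T \<union> {x \<in> ?B. w x > 0})"
        by (rule emeasure_mono) (use Am in \<open>auto simp: T_def\<close>)
      also have "\<dots> \<le> emeasure lborel T + emeasure lborel {x \<in> ?B. w x > 0}"
        by (rule emeasure_subadditive) (use Am in auto)
      also have "\<dots> \<le> emeasure lborel T + ennreal (\<omega> * (H / 2) ^ ?d / 2)"
        using A by (intro add_left_mono) (simp add: \<omega>_def)
      also have "\<dots> = ennreal (\<omega> * (H / 2) ^ ?d / 2) + emeasure lborel T" by (rule add.commute)
      finally show ?thesis unfolding ennreal_add_left_cancel_le by auto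
    qed
    then have "ennreal (F / (2 * H) ^ ?d) * ennreal (\<omega> * (H / 2) ^ ?d / 2) \<le> ennreal (F / (2 * H) ^ ?d) * emeasure lborel T"
      by (rule mult_left_mono) simp
    also have "\<dots> = (\<integral>\<^sup>+y. ennreal (F / (2 * H) ^ ?d) * indicator T y \<partial>lborel)"
      by (simp add: nn_integral_cmult_indicator)
    also have "\<dots> \<le> I x"
      unfolding I_def
    proof (rule nn_integral_mono)
      fix y
      show "ennreal (F / (2 * H) ^ ?d) * indicator T y \<le> ennreal (gagliardo_kernel s f w x y) * indicator N (x, y)"
      proof (cases "y \<in> T")
        case y: True
        then have yB: "y \<in> ?B" and "\<not> w y > 0" using p(1) by (auto simp: T_def)
        with wnn[of y] have wy: "w y = 0" by simp
        have n: "H \<le> norm (x - y)" "norm (x - y) < 2 * H" using y p(2) by (auto simp: T_def)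
        then have N: "(x, y) \<in> N" using x yB by (simp add: N_def)
        have n0: "norm (x - y) > 0" using n H by linarith
        have "w x / (2 * H) powr s \<le> w x / norm (x - y) powr s"
          using n n0 s wx by (intro divide_left_mono powr_mono2 mult_pos_pos) auto
        then have "F \<le> f (w x / norm (x - y) powr s)"
          unfolding F_def using wx by (intro growth_mono[OF g]) auto
        then have "F / (2 * H) ^ ?d \<le> f (w x / norm (x - y) powr s) / norm (x - y) ^ ?d"
          using n n0 F by (intro frac_le power_mono zero_less_power) auto
        then show ?thesis using y N wy wx by (simp add: gagliardo_kernel_def ennreal_leI)
      qed simp
    qed
    finally have "ennreal (2 * 4 ^ ?d / \<omega>) * (ennreal (F / (2 * H) ^ ?d) * ennreal (\<omega> * (H / 2) ^ ?d / 2))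
        \<le> ennreal (2 * 4 ^ ?d / \<omega>) * I x"
      by (rule mult_left_mono) simp
    \<comment> \<open>The ratio of \<open>(H / 2) ^ d\<close> to \<open>(2 * H) ^ d\<close> gives
      \<open>4 ^ d\<close>, and halving the ball gives the 2.\<close>
    moreover have "2 * 4 ^ ?d / \<omega> * (F / (2 * H) ^ ?d * (\<omega> * (H / 2) ^ ?d / 2)) = F"
    proof -
      have "(4::real) ^ ?d = 2 ^ ?d * 2 ^ ?d" by (simp flip: power_mult_distrib)
      then show ?thesis using H \<omega> by (simp add: power_mult_distrib power_divide)
    qed
    ultimately show ?thesis using F H \<omega> x by (simp add: F_def flip: ennreal_mult)
  next
    case False
    then have "x \<notin> ?B \<or> w x = 0" using wnn[of x] by linarith
    then show ?thesis using g by (auto simp: growth_function_def)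
  qed
  have "(\<integral>\<^sup>+x\<in>?B. ennreal (f (w x / (2 * H) powr s)) \<partial>lborel) \<le> (\<integral>\<^sup>+x. ennreal (2 * 4 ^ ?d / \<omega>) * I x \<partial>lborel)"
    by (rule nn_integral_mono) (rule pt)
  also have "\<dots> = ennreal (2 * 4 ^ ?d / \<omega>) * (\<integral>\<^sup>+x. I x \<partial>lborel)"
    by (rule nn_integral_cmult) (rule Im)
  also have "\<dots> \<le> ennreal (2 * 4 ^ ?d / \<omega>) * (ennreal (2 powr q) * Phi_W s f ?B w)"
    unfolding I_def N_def by (intro mult_left_mono annulus_le_Phi_W[OF g s w]) auto
  also have "\<dots> = ennreal (2 * 4 ^ ?d / \<omega> * 2 powr q) * Phi_W s f ?B w"
    using \<omega> by (subst ennreal_mult) (auto simp: mult.assoc)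
  finally show ?thesis by (simp add: \<omega>_def)
qed

text \<open>A Borel function that agrees with \<open>w\<close> almost everywhere is cut off at 0.
  The measure of the positivity set, the integral and the energy do not change; in the energy the
  null set is removed first in \<open>x\<close>, then in \<open>y\<close>.\<close>

lemma Faber_Krahn:
  fixes w :: "'a::euclidean_space \<Rightarrow> real"
  assumes g: "growth_function q f" and s: "0 < s" "s < 1"
    and w: "w \<in> borel_measurable lebesgue" and wnn: "\<And>x. w x \<ge> 0"
    and H: "0 < H" "2 * H \<le> r"
    and A: "emeasure lebesgue {x \<in> ball x0 r. w x > 0} \<le> ennreal (unit_ball_vol (DIM('a)) * (H / 2) ^ DIM('a) / 2)"
  shows "(\<integral>\<^sup>+x\<in>ball x0 r. ennreal (f (w x / (2 * H) powr s)) \<partial>lebesgue)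
    \<le> ennreal (2 * 4 ^ DIM('a) * 2 powr q / unit_ball_vol (DIM('a))) * Phi_W s f (ball x0 r) w"
proof -
  obtain v where v: "v \<in> borel_measurable lborel" "AE x in lborel. w x = v x"
    using completion_ex_borel_measurable_real[OF w] by auto
  define w' where "w' = (\<lambda>x. max (v x) 0)"
  have w': "w' \<in> borel_measurable borel" "\<And>x. w' x \<ge> 0" using v(1) by (auto simp: w'_def)
  have ae: "AE x in lborel. w x = w' x"
    using v(2)
  proof eventually_elim
    case (elim x)
    then show ?case using wnn[of x] by (simp add: w'_def)
  qed
  have "emeasure lborel {x \<in> ball x0 r. w' x > 0} = emeasure lebesgue {x \<in> ball x0 r. w' x > 0}"
  proof -
    have "{x \<in> ball x0 r. w' x > 0} \<in> sets lborel" using w'(1) by measurable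
    then show ?thesis by (simp only: emeasure_completion main_part sets_completionI_sets)
  qed
  also have "\<dots> = emeasure lebesgue {x \<in> ball x0 r. w x > 0}"
  proof (rule emeasure_eq_AE)
    show "AE x in lebesgue. (x \<in> {x \<in> ball x0 r. w' x > 0}) = (x \<in> {x \<in> ball x0 r. w x > 0})"
      using AE_completion[OF ae] by eventually_elim simp
    have wl: "w' \<in> borel_measurable lebesgue"
      using measurable_completion[of w' lborel borel] w'(1) by simp
    have set: "{x \<in> ball x0 r. v x > 0} \<in> sets lebesgue" if "v \<in> borel_measurable lebesgue" for v :: "'a \<Rightarrow> real"
    proof -
      have "v -` {0<..} \<inter> space lebesgue \<in> sets lebesgue"
        by (rule measurable_sets[OF that]) simp
      then have "ball x0 r \<inter> (v -` {0<..} \<inter> space lebesgue) \<in> sets lebesgue"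
        by (intro sets.Int) (auto intro: sets_completionI_sets)
      moreover have "ball x0 r \<inter> (v -` {0<..} \<inter> space lebesgue) = {x \<in> ball x0 r. v x > 0}" by auto
      ultimately show ?thesis by simp
    qed
    show "{x \<in> ball x0 r. w' x > 0} \<in> sets lebesgue" "{x \<in> ball x0 r. w x > 0} \<in> sets lebesgue"
      by (rule set[OF wl], rule set[OF w])
  qed
  finally have "emeasure lborel {x \<in> ball x0 r. w' x > 0} \<le> ennreal (unit_ball_vol (DIM('a)) * (H / 2) ^ DIM('a) / 2)"
    using A by simp
  from Faber_Krahn_borel[OF g s w' H this]
  have "(\<integral>\<^sup>+x\<in>ball x0 r. ennreal (f (w' x / (2 * H) powr s)) \<partial>lborel)
    \<le> ennreal (2 * 4 ^ DIM('a) * 2 powr q / unit_ball_vol (DIM('a))) * Phi_W s f (ball x0 r) w'" .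
  also have "(\<integral>\<^sup>+x\<in>ball x0 r. ennreal (f (w' x / (2 * H) powr s)) \<partial>lborel)
      = (\<integral>\<^sup>+x\<in>ball x0 r. ennreal (f (w x / (2 * H) powr s)) \<partial>lebesgue)"
    unfolding nn_integral_completion
    by (intro nn_integral_cong_AE) (use ae in eventually_elim, simp)
  also have "Phi_W s f (ball x0 r) w' = Phi_W s f (ball x0 r) w"
    unfolding Phi_W_eq_lborel
  proof (intro arg_cong2[where f = times] refl nn_integral_cong_AE)
    show "AE x in lborel. (\<integral>\<^sup>+y. ennreal (gagliardo_kernel s f w' x y) * indicator (ball x0 r \<times> ball x0 r) (x, y) \<partial>lborel)
      = (\<integral>\<^sup>+y. ennreal (gagliardo_kernel s f w x y) * indicator (ball x0 r \<times> ball x0 r) (x, y) \<partial>lborel)"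
      using ae
    proof eventually_elim
      case (elim x)
      note x = this
      show ?case
      proof (rule nn_integral_cong_AE)
        show "AE y in lborel. ennreal (gagliardo_kernel s f w' x y) * indicator (ball x0 r \<times> ball x0 r) (x, y)
          = ennreal (gagliardo_kernel s f w x y) * indicator (ball x0 r \<times> ball x0 r) (x, y)"
          using ae by eventually_elim (simp add: gagliardo_kernel_def x)
      qed
    qed
  qed
  finally show ?thesis .
qed

section \<open>The energy estimate with absorbed tail\<close>

text \<open>Where \<open>b > 0\<close> one has \<open>\<kappa> \<le> L * a\<close>, so the
  derivative moves up to \<open>L * a\<close>, where it is comparable to \<open>f\<close>. With
  \<open>b\<close> and \<open>a\<close> the truncations at a higher and a lower level, this trades
  the L1 norm in the tail term for an integral of \<open>f\<close>; \<open>L\<close> measures the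
  inverse of the level gap.\<close>

lemma level_estimate:
  assumes g: "growth_function q f" and q: "0 \<le> q" and L: "1 \<le> L" and k: "0 < \<kappa>"
    and ab: "0 \<le> b" "b \<le> a" "b > 0 \<Longrightarrow> \<kappa> \<le> L * a"
  shows "gderiv f \<kappa> * b \<le> q * L powr q * f a"
proof (cases "b = 0")
  case True
  then show ?thesis using growth_nonneg[OF g, of a] ab q by simp
next
  case False
  then have b: "b > 0" and ka: "\<kappa> \<le> L * a" using ab by auto
  have a: "a > 0" using b ab by linarith
  have "gderiv f \<kappa> * b \<le> gderiv f (L * a) * a"
    using gderiv_mono[OF g _ ka] gderiv_nonneg[OF g, of "L * a"] k ab L a by (intro mult_mono) auto
  also have "\<dots> \<le> gderiv f (L * a) * (L * a)"
    using gderiv_nonneg[OF g, of "L * a"] L a by (intro mult_left_mono) auto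
  also have "\<dots> \<le> q * f (L * a)"
    using gderiv_le[OF g, of "L * a"] L a by (simp add: mult_ac)
  also have "\<dots> \<le> q * (L powr q * f a)"
    using growth_scale_powr[OF g L, of a] q a by (intro mult_left_mono) auto
  finally show ?thesis by (simp add: mult.assoc)
qed

lemma le_dist_boundary:
  assumes "open \<Omega>" "ball x0 R \<subseteq> \<Omega>" "r \<le> R"
  shows "ereal r \<le> dist_boundary x0 \<Omega>"
  unfolding dist_boundary_def
proof (rule INF_greatest)
  fix y assume "y \<in> frontier \<Omega>"
  then have "y \<notin> \<Omega>" using assms(1) by (simp add: frontier_def interior_open)
  then have "y \<notin> ball x0 R" using assms(2) by auto
  then show "ereal r \<le> ereal (dist x0 y)" using assms(3) by simp
qed

text \<open>The hypothesis \<open>tail\<close> makes \<open>t\<close> admissible in the infimum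
  defining the tail. \<open>gderiv_scale\<close> passes from \<open>t\<close> to
  \<open>\<kappa>\<close>, and \<open>level_estimate\<close> absorbs the resulting derivative
  together with the L1 norm. Both terms on the right of the De Giorgi inequality thus become
  multiples of one integral at the lower level.\<close>

lemma energy_estimate:
  fixes u :: "'a::euclidean_space \<Rightarrow> real"
  assumes g: "growth_function q f" and q: "1 < q" and c: "0 < c" and s: "0 < s" "s < 1"
    and Om: "open \<Omega>" and u: "u \<in> G_plus \<Omega> q c s f" and R: "0 < R" "ball x0 R \<subseteq> \<Omega>"
    and r: "R / 2 \<le> r" "r < r'" "r' \<le> R" and N: "1 \<le> N" "r' / (r' - r) \<le> N"
    and k: "0 < \<kappa>" and t: "0 \<le> t" and d: "0 < \<delta>" "\<delta> < 1" "\<delta> * t \<le> \<kappa>"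
    and tail: "ennreal ((1 - s) * (R / 2) powr s) *
        (\<integral>\<^sup>+ y \<in> - ball x0 (R / 2).
           ennreal (gderiv f (max (u y) 0 / norm (y - x0) powr s) / norm (y - x0) powr (real DIM('a) + s))
         \<partial>lebesgue) \<le> ennreal (gderiv f t)"
    and L: "1 \<le> L" and lev: "0 \<le> l'" "l \<le> l'" "\<kappa> * R powr s \<le> L * (l' - l)"
  shows "Phi_W s f (ball x0 r) (\<lambda>x. max (u x - l') 0) \<le>
    ennreal (c * (2 powr q + 2 * q\<^sup>2) * \<delta> powr (1 - q) * L powr q * N powr (real DIM('a) + q)) *
    (\<integral>\<^sup>+x\<in>ball x0 r'. ennreal (f (max (u x - l) 0 / R powr s)) \<partial>lebesgue)"
proof -
  let ?d = "real DIM('a)"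
  define w where "w = (\<lambda>x. max (u x - l') 0)"
  define v where "v = (\<lambda>x. max (u x - l) 0)"
  define I where "I = (\<integral>\<^sup>+x\<in>ball x0 r'. ennreal (f (v x / R powr s)) \<partial>lebesgue)"
  define T where "T = ennreal (1 - s) * (\<integral>\<^sup>+ y \<in> - ball x0 r.
      ennreal (gderiv f (w y / norm (y - x0) powr s) / norm (y - x0) powr (?d + s)) \<partial>lebesgue)"
  define W where "W = (\<integral>\<^sup>+x\<in>ball x0 r'. ennreal \<bar>w x\<bar> \<partial>lebesgue)"
  define G where "G = q * \<delta> powr (1 - q) * gderiv f \<kappa>"
  have um: "u \<in> borel_measurable lebesgue" using u by (simp add: G_plus_def V_space_def)
  have x0: "x0 \<in> \<Omega>" using R by auto
  have r0: "0 < r" "0 < r'" using R r by auto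
  have Rs: "R powr s > 0" using R by simp
  have wv: "0 \<le> w x" "w x \<le> v x" "0 \<le> v x" for x using lev by (auto simp: w_def v_def)
  have vm: "(\<lambda>x. f (v x / R powr s)) \<in> borel_measurable lebesgue"
  proof (rule growth_measurable[OF g])
    show "(\<lambda>x. v x / R powr s) \<in> borel_measurable lebesgue"
      unfolding v_def using um by (intro borel_measurable_divide borel_measurable_max borel_measurable_diff) auto
  qed (use wv in auto)
  have fvm: "(\<lambda>x. ennreal (f (v x / R powr s)) * indicator (ball x0 r') x) \<in> borel_measurable lebesgue"
    using vm by (intro borel_measurable_times_ennreal borel_measurable_indicator measurable_compose[OF vm measurable_ennreal])
      (auto intro: sets_completionI_sets)
  have wm: "(\<lambda>x. ennreal \<bar>w x\<bar> * indicator (ball x0 r') x) \<in> borel_measurable lebesgue"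
  proof (intro borel_measurable_times_ennreal borel_measurable_indicator)
    have "(\<lambda>x. \<bar>w x\<bar>) \<in> borel_measurable lebesgue" unfolding w_def using um
      by (intro borel_measurable_abs borel_measurable_max borel_measurable_diff) auto
    then show "(\<lambda>x. ennreal \<bar>w x\<bar>) \<in> borel_measurable lebesgue" by (rule measurable_compose[OF _ measurable_ennreal])
  qed (auto intro: sets_completionI_sets)
  \<comment> \<open>Uses \<open>2 powr s \<le> 2\<close>; taken at \<open>r'\<close> and at
    \<open>R / 2\<close> it replaces every length scale by \<open>R\<close>.\<close>
  have half: "R powr s \<le> 2 * \<rho> powr s" if "R / 2 \<le> \<rho>" for \<rho>
  proof -
    have "R powr s \<le> (2 * \<rho>) powr s" using that R s by (intro powr_mono2) auto
    also have "\<dots> = 2 powr s * \<rho> powr s" using that R by (simp add: powr_mult)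
    also have "\<dots> \<le> 2 * \<rho> powr s"
      using powr_mono[of s 1 "2::real"] s by (intro mult_right_mono) auto
    finally show ?thesis .
  qed
  note E = u[unfolded G_plus_def, THEN CollectD, THEN conjunct2, rule_format,
      OF x0 r0(1) r(2) le_dist_boundary[OF Om R(2) r(3)], of l', unfolded Let_def]
  \<comment> \<open>The De Giorgi inequality at level \<open>l'\<close>; the energy is at most its
    left side because the cross term is nonnegative.\<close>
  have main: "Phi_W s f (ball x0 r) w \<le>
      ennreal (c * (r' / (r' - r)) powr q) * Phi_L f (ball x0 r') (\<lambda>x. w x / r' powr s)
      + ennreal (c * (r' / (r' - r)) powr (?d + s * q)) * W * T"
    unfolding G_plus_def Let_def W_def T_def w_def
    by (rule order_trans[OF _ E]) (rule add_increasing2, simp_all)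
  have x: "1 \<le> r' / (r' - r)" using r r0 by (simp add: field_simps)
  \<comment> \<open>The ratio is at least 1 and \<open>s * q \<le> q\<close>, so one factor
    \<open>N powr (?d + q)\<close> dominates both powers.\<close>
  have N1: "(r' / (r' - r)) powr p \<le> N powr (?d + q)" if "0 \<le> p" "p \<le> ?d + q" for p
  proof -
    have "(r' / (r' - r)) powr p \<le> N powr p" using N x that by (intro powr_mono2) auto
    also have "\<dots> \<le> N powr (?d + q)" using that N by (intro powr_mono) auto
    finally show ?thesis .
  qed
  have "Phi_L f (ball x0 r') (\<lambda>x. w x / r' powr s)
      \<le> (\<integral>\<^sup>+x. ennreal (2 powr q) * (ennreal (f (v x / R powr s)) * indicator (ball x0 r') x) \<partial>lebesgue)"
    unfolding Phi_L_def
  proof (rule nn_integral_mono)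
    fix x
    have "\<bar>w x / r' powr s\<bar> \<le> 2 * (v x / R powr s)"
    proof -
      have "w x * R powr s \<le> v x * (2 * r' powr s)"
        using half[of r'] r wv[of x] by (intro mult_mono) auto
      then show ?thesis using wv[of x] Rs r0 by (simp add: field_simps)
    qed
    then have "f \<bar>w x / r' powr s\<bar> \<le> f (2 * (v x / R powr s))" by (intro growth_mono[OF g]) auto
    also have "\<dots> \<le> 2 powr q * f (v x / R powr s)" using wv by (intro growth_scale_powr[OF g]) auto
    finally show "ennreal (f \<bar>w x / r' powr s\<bar>) * indicator (ball x0 r') x
        \<le> ennreal (2 powr q) * (ennreal (f (v x / R powr s)) * indicator (ball x0 r') x)"
      by (auto simp: indicator_def ennreal_leI simp flip: ennreal_mult')
  qed
  also have "\<dots> = ennreal (2 powr q) * I" unfolding I_def by (rule nn_integral_cmult[OF fvm])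
  finally have t1: "Phi_L f (ball x0 r') (\<lambda>x. w x / r' powr s) \<le> ennreal (2 powr q) * I" .
  have G: "G \<ge> 0" unfolding G_def using q gderiv_nonneg[OF g, of \<kappa>] k by simp
  have R2: "(R / 2) powr s > 0" using R by simp
  \<comment> \<open>The domain grows since \<open>r \<ge> R / 2\<close>, and \<open>w\<close> is
    below the positive part of \<open>u\<close> since \<open>l' \<ge> 0\<close>.\<close>
  have "T \<le> ennreal (1 - s) * (\<integral>\<^sup>+ y \<in> - ball x0 (R / 2).
      ennreal (gderiv f (max (u y) 0 / norm (y - x0) powr s) / norm (y - x0) powr (?d + s)) \<partial>lebesgue)"
    (is "_ \<le> _ * ?Y")
    unfolding T_def
  proof (intro mult_left_mono nn_integral_mono)
    fix y
    have "gderiv f (w y / norm (y - x0) powr s) \<le> gderiv f (max (u y) 0 / norm (y - x0) powr s)"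
      using lev by (intro gderiv_mono[OF g] divide_right_mono) (auto simp: w_def)
    then have "gderiv f (w y / norm (y - x0) powr s) / norm (y - x0) powr (?d + s)
      \<le> gderiv f (max (u y) 0 / norm (y - x0) powr s) / norm (y - x0) powr (?d + s)"
      by (rule divide_right_mono) simp
    then show "ennreal (gderiv f (w y / norm (y - x0) powr s) / norm (y - x0) powr (?d + s)) * indicator (- ball x0 r) y
      \<le> ennreal (gderiv f (max (u y) 0 / norm (y - x0) powr s) / norm (y - x0) powr (?d + s)) * indicator (- ball x0 (R / 2)) y"
      using r by (intro mult_mono ennreal_leI) (auto simp: indicator_def)
  qed simp
  also have "\<dots> \<le> ennreal (G / (R / 2) powr s)"
  proof -
    have "ennreal ((R / 2) powr s) * (ennreal (1 - s) * ?Y) \<le> ennreal (gderiv f t)"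
      using tail R2 s by (simp add: ennreal_mult' mult_ac)
    also have "\<dots> \<le> ennreal G"
      unfolding G_def by (intro ennreal_leI gderiv_scale[OF g d(1,2) t k d(3)])
    finally have *: "ennreal (1 / (R / 2) powr s) * (ennreal ((R / 2) powr s) * (ennreal (1 - s) * ?Y))
        \<le> ennreal (1 / (R / 2) powr s) * ennreal G" by (rule mult_left_mono) simp
    have "ennreal (1 / (R / 2) powr s) * ennreal ((R / 2) powr s) = 1"
      using R2 R by (subst ennreal_mult[symmetric]) auto
    with * show ?thesis using G by (simp add: mult.assoc[symmetric] ennreal_mult'[symmetric])
  qed
  finally have T: "T \<le> ennreal (G / (R / 2) powr s)" .
  have "W * T \<le> ennreal (G / (R / 2) powr s) * W"
    using T by (subst mult.commute) (rule mult_right_mono, auto)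
  also have "\<dots> = (\<integral>\<^sup>+x. ennreal (G / (R / 2) powr s) * (ennreal \<bar>w x\<bar> * indicator (ball x0 r') x) \<partial>lebesgue)"
    unfolding W_def by (rule nn_integral_cmult[OF wm, symmetric])
  also have "\<dots> \<le> (\<integral>\<^sup>+x. ennreal (2 * q\<^sup>2 * \<delta> powr (1 - q) * L powr q) *
      (ennreal (f (v x / R powr s)) * indicator (ball x0 r') x) \<partial>lebesgue)"
  proof (rule nn_integral_mono)
    fix x
    have "gderiv f \<kappa> * (w x / R powr s) \<le> q * L powr q * f (v x / R powr s)"
    proof (rule level_estimate[OF g _ L k])
      show "\<kappa> \<le> L * (v x / R powr s)" if "0 < w x / R powr s"
      proof -
        have "l' < u x" using that by (auto simp: w_def zero_less_divide_iff max_def split: if_splits)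
        then have "L * (l' - l) \<le> L * v x" using L lev by (intro mult_left_mono) (auto simp: v_def)
        with lev(3) have "\<kappa> * R powr s \<le> L * v x" by linarith
        then show ?thesis using Rs by (simp add: field_simps)
      qed
    qed (use wv[of x] q in \<open>auto simp: divide_right_mono\<close>)
    then have *: "2 * (q * \<delta> powr (1 - q)) * (gderiv f \<kappa> * (w x / R powr s))
        \<le> 2 * (q * \<delta> powr (1 - q)) * (q * L powr q * f (v x / R powr s))"
      using q by (intro mult_left_mono) auto
    have "1 / (R / 2) powr s \<le> 2 / R powr s"
      using half[of "R / 2"] Rs R2 by (simp add: field_simps)
    then have "G * w x * (1 / (R / 2) powr s) \<le> G * w x * (2 / R powr s)"
      using G wv[of x] by (intro mult_left_mono) auto
    also have "\<dots> = 2 * (q * \<delta> powr (1 - q)) * (gderiv f \<kappa> * (w x / R powr s))"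
      by (simp add: G_def)
    also note *
    also have "2 * (q * \<delta> powr (1 - q)) * (q * L powr q * f (v x / R powr s))
        = 2 * q\<^sup>2 * \<delta> powr (1 - q) * L powr q * f (v x / R powr s)"
      by (simp add: power2_eq_square)
    finally have "G / (R / 2) powr s * \<bar>w x\<bar> \<le> 2 * q\<^sup>2 * \<delta> powr (1 - q) * L powr q * f (v x / R powr s)"
      using wv[of x] by (simp add: mult_ac)
    then show "ennreal (G / (R / 2) powr s) * (ennreal \<bar>w x\<bar> * indicator (ball x0 r') x)
      \<le> ennreal (2 * q\<^sup>2 * \<delta> powr (1 - q) * L powr q) * (ennreal (f (v x / R powr s)) * indicator (ball x0 r') x)"
      using G q by (auto simp: indicator_def ennreal_leI simp flip: ennreal_mult')
  qed
  also have "\<dots> = ennreal (2 * q\<^sup>2 * \<delta> powr (1 - q) * L powr q) * I"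
    unfolding I_def by (rule nn_integral_cmult[OF fvm])
  finally have t2: "W * T \<le> ennreal (2 * q\<^sup>2 * \<delta> powr (1 - q) * L powr q) * I" .
  have "Phi_W s f (ball x0 r) w \<le> ennreal (c * N powr (?d + q)) * (ennreal (2 powr q) * I)
     + ennreal (c * N powr (?d + q)) * (ennreal (2 * q\<^sup>2 * \<delta> powr (1 - q) * L powr q) * I)"
  proof (rule order.trans[OF main], rule add_mono)
    show "ennreal (c * (r' / (r' - r)) powr q) * Phi_L f (ball x0 r') (\<lambda>x. w x / r' powr s)
      \<le> ennreal (c * N powr (?d + q)) * (ennreal (2 powr q) * I)"
      using t1 c q N1[of q] by (intro mult_mono ennreal_leI mult_left_mono) auto
    have "s * q \<le> q" using s q by simp
    then show "ennreal (c * (r' / (r' - r)) powr (?d + s * q)) * W * T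
      \<le> ennreal (c * N powr (?d + q)) * (ennreal (2 * q\<^sup>2 * \<delta> powr (1 - q) * L powr q) * I)"
      unfolding mult.assoc[of _ W T] using c q s N1[of "?d + s * q"]
      by (intro mult_mono[OF ennreal_leI t2] mult_left_mono) auto
  qed
  also have "\<dots> = ennreal (c * N powr (?d + q) * (2 powr q + 2 * q\<^sup>2 * \<delta> powr (1 - q) * L powr q)) * I"
    using c q by (simp add: ennreal_mult' distrib_right distrib_left mult.assoc)
  also have "\<dots> \<le> ennreal (c * (2 powr q + 2 * q\<^sup>2) * \<delta> powr (1 - q) * L powr q * N powr (?d + q)) * I"
  proof (intro mult_right_mono ennreal_leI)
    \<comment> \<open>The factor \<open>\<delta> powr (1 - q) * L powr q\<close> is at least 1, so
      the local term can carry it as well.\<close>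
    have "1 \<le> \<delta> powr (1 - q)" using d q powr_mono'[of "1 - q" 0 \<delta>] by simp
    moreover have "1 \<le> L powr q" using L q ge_one_powr_ge_zero by simp
    ultimately have "1 * 1 \<le> \<delta> powr (1 - q) * L powr q" by (intro mult_mono) auto
    then have "2 powr q * 1 \<le> 2 powr q * (\<delta> powr (1 - q) * L powr q)" by (intro mult_left_mono) auto
    then have "2 powr q + 2 * q\<^sup>2 * \<delta> powr (1 - q) * L powr q \<le> (2 powr q + 2 * q\<^sup>2) * (\<delta> powr (1 - q) * L powr q)"
      by (simp add: algebra_simps)
    then have "c * N powr (?d + q) * (2 powr q + 2 * q\<^sup>2 * \<delta> powr (1 - q) * L powr q)
      \<le> c * N powr (?d + q) * ((2 powr q + 2 * q\<^sup>2) * (\<delta> powr (1 - q) * L powr q))"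
      using c by (intro mult_left_mono) auto
    then show "c * N powr (?d + q) * (2 powr q + 2 * q\<^sup>2 * \<delta> powr (1 - q) * L powr q)
      \<le> c * (2 powr q + 2 * q\<^sup>2) * \<delta> powr (1 - q) * L powr q * N powr (?d + q)"
      by (simp add: mult_ac)
  qed simp
  finally show ?thesis by (simp add: w_def v_def I_def)
qed

section \<open>The De Giorgi iteration\<close>

text \<open>The exponent \<open>\<beta> = s0 / (2 d)\<close> is smaller than the available gain \<open>s / d\<close> in the
  Faber-Krahn inequality; the ratio \<open>2 powr (- (B / \<beta>))\<close> makes the bound
  \<open>a n \<le> M * \<mu> ^ n\<close> reproduce itself.\<close>

lemma De_Giorgi_step_constants:
  fixes d n :: nat and \<beta> q \<theta> K s D :: real
  defines "B \<equiv> 1 + q + (real d + 2 * q)"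
  defines "\<mu> \<equiv> 2 powr (- (B / \<beta>))"
  defines "y \<equiv> 2 powr (1 + q * real (n + 1)) * \<theta> * \<mu> ^ n"
  assumes d: "d \<ge> 1" and q: "1 < q" and \<beta>: "0 < \<beta>" "\<beta> \<le> 1" and \<theta>: "0 < \<theta>" and K: "0 \<le> K" and D: "0 < D"
    and s: "real d * \<beta> \<le> s" "s \<le> 1"
    and small1: "2 powr (1 + q) * \<theta> \<le> (1 / 8) ^ d"
    and small2: "4 * 2 powr B * K / D powr (real d + q) * \<theta> powr \<beta> \<le> \<mu>"
  shows "0 < y" "y \<le> (1 / 8) ^ d"
    "(4 * y powr (1 / real d)) powr s *
      (K * (2 ^ (n + 1)) powr q * (2 ^ (n + 1) / D) powr (real d + q)) \<le> \<mu>"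
proof -
  \<comment> \<open>In the iteration \<open>y\<close> is twice the bound for the measure of the
    superlevel set, relative to \<open>\<omega> * R ^ d\<close>.\<close>
  have mn: "\<mu> ^ n = 2 powr (- (B / \<beta>) * real n)" by (simp add: \<mu>_def powr_power mult.commute)
  \<comment> \<open>The aim is \<open>q \<le> B / \<beta>\<close>: the decay of
    \<open>\<mu> ^ n\<close> beats the growth \<open>2 powr (q * n)\<close> caused by the shrinking
    level gaps, so \<open>y\<close> is bounded by its value at \<open>n = 0\<close>.\<close>
  have Bq: "q \<le> B" "0 \<le> B" using q by (auto simp: B_def)
  have "B * \<beta> \<le> B * 1" using \<beta> Bq by (intro mult_left_mono) auto
  then have "B \<le> B / \<beta>" using \<beta> by (simp add: field_simps)
  with Bq have Bb: "q \<le> B / \<beta>" by simp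
  show y0: "0 < y" using \<theta> by (simp add: y_def mn)
  have y_eq: "y = 2 powr (1 + q * real (n + 1) - B / \<beta> * real n) * \<theta>"
    by (simp add: y_def mn powr_diff powr_minus divide_inverse)
  have "q * real n \<le> B / \<beta> * real n" using Bb by (intro mult_right_mono) auto
  then have "y \<le> 2 powr (1 + q) * \<theta>"
    unfolding y_eq using \<theta> by (intro mult_right_mono powr_mono) (auto simp: algebra_simps)
  then show y8: "y \<le> (1 / 8) ^ d" using small1 by simp
  define z where "z = y powr (1 / real d)"
  have z0: "z > 0" using y0 by (simp add: z_def)
  have "z \<le> ((1 / 8) ^ d) powr (1 / real d)" unfolding z_def using y8 y0 by (intro powr_mono2) auto
  also have "\<dots> = 1 / 8" using d by (simp add: powr_realpow[symmetric] powr_powr)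
  finally have z8: "z \<le> 1 / 8" .
  \<comment> \<open>As \<open>4 * z \<le> 1/2\<close>, lowering the exponent from \<open>s\<close>
    to \<open>d * \<beta>\<close> increases the power; the gain becomes
    \<open>y powr \<beta>\<close>, uniformly in \<open>s\<close>.\<close>
  have "(4 * z) powr s \<le> (4 * z) powr (real d * \<beta>)"
    using z0 z8 s by (intro powr_mono') auto
  also have "\<dots> = 4 powr (real d * \<beta>) * y powr \<beta>"
    using z0 d y0 by (simp add: powr_mult z_def powr_powr)
  also have "\<dots> \<le> 4 powr 1 * y powr \<beta>"
    using s by (intro mult_right_mono powr_mono) auto
  finally have h: "(4 * z) powr s \<le> 4 * y powr \<beta>" by simp
  \<comment> \<open>Here \<open>\<mu> ^ n\<close> turns into \<open>2 powr (- B * n)\<close>.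
    \<open>B\<close> sums the exponents multiplying \<open>n + 1\<close>: \<open>1 + q\<close> from
    \<open>y\<close> and \<open>d + 2 * q\<close> from the gap factors. What remains is
    \<open>2 powr B\<close> for every \<open>n\<close>.\<close>
  have "y powr \<beta> = 2 powr (\<beta> * (1 + q * real (n + 1)) - B * real n) * \<theta> powr \<beta>"
  proof -
    have "(1 + q * real (n + 1) - B / \<beta> * real n) * \<beta> = \<beta> * (1 + q * real (n + 1)) - B * real n"
      using \<beta> by (simp add: field_simps)
    then show ?thesis unfolding y_eq using \<theta> by (simp add: powr_mult powr_powr)
  qed
  also have "\<dots> \<le> 2 powr ((1 + q) * real (n + 1) - B * real n) * \<theta> powr \<beta>"
  proof (intro mult_right_mono powr_mono diff_right_mono)
    have "\<beta> * (1 + q * real (n + 1)) \<le> 1 * (1 + q * real (n + 1))"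
      using \<beta> q by (intro mult_right_mono) auto
    then show "\<beta> * (1 + q * real (n + 1)) \<le> (1 + q) * real (n + 1)" by (simp add: algebra_simps)
  qed auto
  finally have yb: "y powr \<beta> \<le> 2 powr ((1 + q) * real (n + 1) - B * real n) * \<theta> powr \<beta>" .
  have e: "(2 ^ (n + 1)) powr q * (2 ^ (n + 1) / D) powr (real d + q)
      = 2 powr ((real d + 2 * q) * real (n + 1)) / D powr (real d + q)" (is "?E = _")
  proof -
    have "(2::real) ^ (n + 1) = 2 powr real (n + 1)" by (subst powr_realpow) auto
    then have "?E = 2 powr (real (n + 1) * q) * 2 powr (real (n + 1) * (real d + q)) / D powr (real d + q)"
      using D by (simp only: powr_divide powr_powr) simp
    also have "2 powr (real (n + 1) * q) * 2 powr (real (n + 1) * (real d + q)) = 2 powr ((real d + 2 * q) * real (n + 1))"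
      unfolding powr_add[symmetric] by (simp add: algebra_simps)
    finally show ?thesis .
  qed
  have "(4 * z) powr s * (K * ?E)
      \<le> 4 * (2 powr ((1 + q) * real (n + 1) - B * real n) * \<theta> powr \<beta>) * (K * ?E)"
    using h yb K by (intro mult_right_mono) auto
  also have "\<dots> = 4 * (2 powr ((1 + q) * real (n + 1) - B * real n) * 2 powr ((real d + 2 * q) * real (n + 1)))
      * K / D powr (real d + q) * \<theta> powr \<beta>"
    by (simp only: e) simp
  also have "2 powr ((1 + q) * real (n + 1) - B * real n) * 2 powr ((real d + 2 * q) * real (n + 1)) = 2 powr B"
    unfolding powr_add[symmetric] by (simp add: B_def algebra_simps)
  finally show "(4 * y powr (1 / real d)) powr s *
      (K * (2 ^ (n + 1)) powr q * (2 ^ (n + 1) / D) powr (real d + q)) \<le> \<mu>"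
    using small2 by (simp add: z_def mult.assoc)
qed

text \<open>Induction on \<open>a n \<le> M * \<mu> ^ n\<close>: \<open>start\<close> is the case
  \<open>n = 0\<close>, \<open>small1\<close> makes the radius \<open>H\<close> fit into
  Faber-Krahn, and \<open>small2\<close> makes each step cost at most a factor \<open>\<mu>\<close>.
  In the limit the truncation at level \<open>\<kappa> * R powr s\<close> has zero integral on the
  inner ball.\<close>

lemma De_Giorgi_iteration:
  fixes u :: "'a::euclidean_space \<Rightarrow> real"
  assumes g: "growth_function q f" and q: "1 < q" and c: "0 < c" and s: "0 < s" "s < 1"
    and Om: "open \<Omega>" and u: "u \<in> G_plus \<Omega> q c s f" and R: "0 < R" "ball x0 R \<subseteq> \<Omega>"
    and rt: "1 / 2 \<le> \<rho>" "\<rho> < \<tau>" "\<tau> \<le> 1"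
    and k: "0 < \<kappa>" and t: "0 \<le> t" and d: "0 < \<delta>" "\<delta> < 1" "\<delta> * t \<le> \<kappa>"
    and tail: "ennreal ((1 - s) * (R / 2) powr s) *
        (\<integral>\<^sup>+ y \<in> - ball x0 (R / 2).
           ennreal (gderiv f (max (u y) 0 / norm (y - x0) powr s) / norm (y - x0) powr (real DIM('a) + s))
         \<partial>lebesgue) \<le> ennreal (gderiv f t)"
    and \<beta>: "0 < \<beta>" "real DIM('a) * \<beta> \<le> s" and \<theta>: "0 < \<theta>"
    and B: "B = 1 + q + (real DIM('a) + 2 * q)"
    and C1: "C1 = 2 * 4 ^ DIM('a) * 2 powr q / unit_ball_vol (real DIM('a)) * (c * (2 powr q + 2 * q\<^sup>2))"
    and small1: "2 powr (1 + q) * \<theta> \<le> (1 / 8) ^ DIM('a)"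
    and small2: "4 * 2 powr B * (C1 * \<delta> powr (1 - q)) / (\<tau> - \<rho>) powr (real DIM('a) + q) * \<theta> powr \<beta> \<le> 2 powr (- (B / \<beta>))"
    and start: "(\<integral>\<^sup>+x\<in>ball x0 (\<tau> * R). ennreal (f (max (u x) 0 / R powr s)) \<partial>lebesgue)
        \<le> ennreal (unit_ball_vol (real DIM('a)) * R ^ DIM('a) * \<theta> * f \<kappa>)"
  shows "AE x in lebesgue. x \<in> ball x0 (\<rho> * R) \<longrightarrow> u x \<le> \<kappa> * R powr s"
proof -
  let ?d = "DIM('a)"
  define \<omega> where "\<omega> = unit_ball_vol (real ?d)"
  define \<mu> where "\<mu> = 2 powr (- (B / \<beta>))"
  define K where "K = C1 * \<delta> powr (1 - q)"
  define M where "M = \<omega> * R ^ ?d * \<theta> * f \<kappa>"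
  \<comment> \<open>Consecutive gaps are \<open>R * (\<tau> - \<rho>) / 2 ^ (n + 1)\<close> for
    radii and \<open>\<kappa> * R powr s / 2 ^ (n + 1)\<close> for levels; one
    \<open>L = 2 ^ (n + 1)\<close> serves both.\<close>
  define r where "r = (\<lambda>n. R * (\<rho> + (\<tau> - \<rho>) / 2 ^ n))"
  define l where "l = (\<lambda>n. \<kappa> * R powr s * (1 - 1 / 2 ^ n))"
  define w where "w = (\<lambda>n x. max (u x - l n) 0)"
  define a where "a = (\<lambda>n. \<integral>\<^sup>+x\<in>ball x0 (r n). ennreal (f (w n x / R powr s)) \<partial>lebesgue)"
  have \<omega>: "\<omega> > 0" by (simp add: \<omega>_def)
  have d1: "?d \<ge> 1" by (simp add: Suc_le_eq)
  have \<beta>1: "\<beta> \<le> 1"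
  proof -
    have "1 * \<beta> \<le> real ?d * \<beta>" using d1 \<beta> by (intro mult_right_mono) auto
    then show ?thesis using \<beta> s by linarith
  qed
  have C1p: "C1 > 0" unfolding C1 using c q by (intro mult_pos_pos divide_pos_pos add_pos_pos) auto
  then have K: "K \<ge> 0" by (simp add: K_def)
  have fk: "f \<kappa> > 0" using growth_strict_mono[OF g, of 0 \<kappa>] k g by (simp add: growth_function_def)
  have M: "M > 0" using \<omega> R \<theta> fk by (simp add: M_def)
  have Rs: "R powr s > 0" using R by simp
  have um: "u \<in> borel_measurable lebesgue" using u by (simp add: G_plus_def V_space_def)
  have wm: "w n \<in> borel_measurable lebesgue" for n
    unfolding w_def using um by (intro borel_measurable_max borel_measurable_diff) auto
  have w0: "0 \<le> w n x" for n x by (simp add: w_def)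
  have fwm: "(\<lambda>x. ennreal (f (w n x / R powr s)) * indicator (ball x0 p) x) \<in> borel_measurable lebesgue" for n p
  proof (intro borel_measurable_times_ennreal borel_measurable_indicator)
    have "(\<lambda>x. f (w n x / R powr s)) \<in> borel_measurable lebesgue"
      using wm w0 by (intro growth_measurable[OF g]) auto
    then show "(\<lambda>x. ennreal (f (w n x / R powr s))) \<in> borel_measurable lebesgue"
      by (rule measurable_compose[OF _ measurable_ennreal])
  qed (auto intro: sets_completionI_sets)
  have bound: "a n \<le> ennreal (M * \<mu> ^ n)" for n
  proof (induction n)
    case 0
    show ?case using start by (simp add: a_def r_def w_def l_def M_def \<omega>_def mult.commute)
  next
    case (Suc n)
    define L where "L = (2::real) ^ (n + 1)"
    define y where "y = 2 powr (1 + q * real (n + 1)) * \<theta> * \<mu> ^ n"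
    define z where "z = y powr (1 / real ?d)"
    \<comment> \<open>Chosen so that \<open>\<omega> * (H / 2) ^ d / 2\<close> equals the Chebyshev
      bound for the measure of \<open>A\<close>.\<close>
    define H where "H = 2 * R * z"
    define A where "A = {x \<in> ball x0 (r (Suc n)). w (Suc n) x > 0}"
    note step = De_Giorgi_step_constants[OF d1 q \<beta>(1) \<beta>1 \<theta> K _ \<beta>(2) _ small1, of "\<tau> - \<rho>" n,
        folded B \<mu>_def L_def, unfolded K_def, OF _ _ small2[folded \<mu>_def], folded K_def]
    have y0: "0 < y" and y8: "y \<le> (1 / 8) ^ ?d"
      and fin: "(4 * z) powr s * (K * L powr q * (L / (\<tau> - \<rho>)) powr (real ?d + q)) \<le> \<mu>"
      using step rt s by (auto simp: y_def z_def)
    have L: "L \<ge> 1" "L > 0" unfolding L_def by (rule one_le_power, simp, rule zero_less_power, simp)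
    have z0: "z > 0" using y0 by (simp add: z_def)
    have zd: "z ^ ?d = y" using y0 d1 by (simp add: z_def powr_power)
    have "z ^ ?d \<le> (1 / 8) ^ ?d" using y8 zd by simp
    then have z8: "z \<le> 1 / 8" using power_le_imp_le_base[of z "?d - 1" "1/8"] d1 by simp
    have H0: "H > 0" using R z0 by (simp add: H_def)
    have rn: "R / 2 \<le> r m" "r m \<le> R" for m
    proof -
      have "(\<tau> - \<rho>) / 2 ^ m \<le> (\<tau> - \<rho>) / 1" using rt by (intro divide_left_mono) auto
      then have "\<rho> + (\<tau> - \<rho>) / 2 ^ m \<le> 1" using rt by simp
      then have "R * (\<rho> + (\<tau> - \<rho>) / 2 ^ m) \<le> R * 1" using R by (intro mult_left_mono) auto
      then show "r m \<le> R" by (simp add: r_def)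
      have "1 / 2 \<le> \<rho> + (\<tau> - \<rho>) / 2 ^ m" using rt by (intro add_increasing2) auto
      then have "R * (1 / 2) \<le> R * (\<rho> + (\<tau> - \<rho>) / 2 ^ m)" using R by (intro mult_left_mono) auto
      then show "R / 2 \<le> r m" by (simp add: r_def)
    qed
    have rdiff: "r n - r (Suc n) = R * (\<tau> - \<rho>) / L"
      by (simp add: r_def L_def field_simps)
    then have rlt: "r (Suc n) < r n" using R rt L by (smt (verit) divide_pos_pos mult_pos_pos)
    have "r n / (r n - r (Suc n)) \<le> R / (r n - r (Suc n))"
      using rn rlt by (intro divide_right_mono) auto
    also have "\<dots> = L / (\<tau> - \<rho>)" unfolding rdiff using R rt L by simp
    finally have Nle: "r n / (r n - r (Suc n)) \<le> L / (\<tau> - \<rho>)" .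
    have N1: "1 \<le> L / (\<tau> - \<rho>)" using L rt by (simp add: field_simps)
    have ldiff: "l (Suc n) - l n = \<kappa> * R powr s / L"
      by (simp add: l_def L_def field_simps)
    then have lmono: "l n \<le> l (Suc n)" using k Rs L by (smt (verit) divide_nonneg_nonneg mult_nonneg_nonneg)
    have l0: "0 \<le> l (Suc n)"
    proof -
      have "(1::real) \<le> 2 ^ Suc n" by (rule one_le_power) simp
      then have "1 / 2 ^ Suc n \<le> (1::real)" by simp
      then show ?thesis using k Rs unfolding l_def by (intro mult_nonneg_nonneg) auto
    qed
    have Am: "A \<in> sets lebesgue"
    proof -
      have "w (Suc n) -` {0<..} \<inter> space lebesgue \<in> sets lebesgue"
        by (rule measurable_sets[OF wm]) simp
      then have "ball x0 (r (Suc n)) \<inter> (w (Suc n) -` {0<..} \<inter> space lebesgue) \<in> sets lebesgue"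
        by (intro sets.Int) (auto intro: sets_completionI_sets)
      moreover have "ball x0 (r (Suc n)) \<inter> (w (Suc n) -` {0<..} \<inter> space lebesgue) = A" by (auto simp: A_def)
      ultimately show ?thesis by simp
    qed
    \<comment> \<open>Chebyshev: on \<open>A\<close> the function \<open>u\<close> exceeds
      \<open>l n\<close> by at least \<open>\<kappa> * R powr s / L\<close>, and scaling by
      \<open>L\<close> costs \<open>L powr q\<close>.\<close>
    have "ennreal (f \<kappa> / L powr q) * emeasure lebesgue A
        = (\<integral>\<^sup>+x. ennreal (f \<kappa> / L powr q) * indicator A x \<partial>lebesgue)"
      using Am by (simp add: nn_integral_cmult_indicator)
    also have "\<dots> \<le> a n"
      unfolding a_def
    proof (rule nn_integral_mono)
      fix x
      show "ennreal (f \<kappa> / L powr q) * indicator A x \<le> ennreal (f (w n x / R powr s)) * indicator (ball x0 (r n)) x"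
      proof (cases "x \<in> A")
        case True
        then have x: "x \<in> ball x0 (r n)" and ul: "u x > l (Suc n)"
          using rlt by (auto simp: A_def w_def max_def split: if_splits)
        have "\<kappa> * R powr s / L \<le> w n x" using ul ldiff by (simp add: w_def)
        then have "\<kappa> \<le> L * (w n x / R powr s)" using L Rs by (simp add: field_simps)
        then have "f \<kappa> \<le> f (L * (w n x / R powr s))" using k by (intro growth_mono[OF g]) auto
        also have "\<dots> \<le> L powr q * f (w n x / R powr s)" using L w0 by (intro growth_scale_powr[OF g]) auto
        finally have "f \<kappa> / L powr q \<le> f (w n x / R powr s)" using L by (simp add: field_simps)
        then show ?thesis using True x by (simp add: ennreal_leI)
      qed simp
    qed
    also note Suc.IH
    finally have "ennreal (L powr q / f \<kappa>) * (ennreal (f \<kappa> / L powr q) * emeasure lebesgue A)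
        \<le> ennreal (L powr q / f \<kappa>) * ennreal (M * \<mu> ^ n)" by (rule mult_left_mono) simp
    moreover have "ennreal (L powr q / f \<kappa>) * ennreal (f \<kappa> / L powr q) = 1"
      using fk L by (subst ennreal_mult[symmetric]) auto
    ultimately have "emeasure lebesgue A \<le> ennreal (L powr q / f \<kappa> * (M * \<mu> ^ n))"
      using fk by (simp add: mult.assoc[symmetric] ennreal_mult'[symmetric])
    also have "L powr q / f \<kappa> * (M * \<mu> ^ n) = \<omega> * (H / 2) ^ ?d / 2"
    proof -
      have "L powr q = 2 powr (q * real (n + 1))"
        unfolding L_def by (simp add: powr_realpow[symmetric] powr_powr mult.commute del: power_Suc)
      then have "L powr q * \<theta> * \<mu> ^ n = y / 2" by (simp add: y_def powr_add)
      moreover have "(H / 2) ^ ?d = R ^ ?d * y" by (simp add: H_def power_mult_distrib zd)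
      ultimately show ?thesis using fk by (simp add: M_def field_simps)
    qed
    finally have Asmall: "emeasure lebesgue A \<le> ennreal (\<omega> * (H / 2) ^ ?d / 2)" .
    \<comment> \<open>Gives \<open>2 * H = 4 * R * z \<le> R / 2\<close>, which is below every
      radius of the sequence.\<close>
    have "R * z \<le> R * (1 / 8)" using z8 R by (intro mult_left_mono) auto
    then have H2: "2 * H \<le> r (Suc n)" using rn[of "Suc n"] by (simp add: H_def)
    have z4: "4 * z \<le> 1" using z8 by simp
    have FK: "(\<integral>\<^sup>+x\<in>ball x0 (r (Suc n)). ennreal (f (w (Suc n) x / (2 * H) powr s)) \<partial>lebesgue)
      \<le> ennreal (2 * 4 ^ ?d * 2 powr q / \<omega>) * Phi_W s f (ball x0 (r (Suc n))) (w (Suc n))"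
      unfolding \<omega>_def
      by (rule Faber_Krahn[OF g s wm w0 H0 H2]) (use Asmall in \<open>simp add: A_def \<omega>_def\<close>)
    have EE: "Phi_W s f (ball x0 (r (Suc n))) (w (Suc n)) \<le>
      ennreal (c * (2 powr q + 2 * q\<^sup>2) * \<delta> powr (1 - q) * L powr q * (L / (\<tau> - \<rho>)) powr (real ?d + q)) * a n"
      unfolding w_def a_def
      by (rule energy_estimate[OF g q c s Om u R rn(1) rlt rn(2) N1 Nle k t d tail L(1) l0 lmono])
        (use L ldiff in simp)
    \<comment> \<open>The superlinear gain: \<open>2 * H\<close> is \<open>4 * z\<close> times
      \<open>R\<close> with \<open>4 * z \<le> 1\<close>, so convexity extracts
      \<open>(4 * z) powr s\<close>, a power of the measure bound.\<close>
    have "a (Suc n) \<le> (\<integral>\<^sup>+x. ennreal ((4 * z) powr s) *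
        (ennreal (f (w (Suc n) x / (2 * H) powr s)) * indicator (ball x0 (r (Suc n))) x) \<partial>lebesgue)"
      unfolding a_def
    proof (rule nn_integral_mono)
      fix x
      have "(2 * H) powr s = (4 * z) powr s * R powr s"
        using R z0 by (simp add: H_def powr_mult[symmetric] mult_ac)
      then have "w (Suc n) x / R powr s = (4 * z) powr s * (w (Suc n) x / (2 * H) powr s)"
        using z0 by simp
      then have "f (w (Suc n) x / R powr s) \<le> (4 * z) powr s * f (w (Suc n) x / (2 * H) powr s)"
        using growth_scale_le[OF g, of "(4 * z) powr s" "w (Suc n) x / (2 * H) powr s"] z0 z4 s w0[of "Suc n" x]
        by (simp add: powr_le1)
      then show "ennreal (f (w (Suc n) x / R powr s)) * indicator (ball x0 (r (Suc n))) x \<le> ennreal ((4 * z) powr s) *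
        (ennreal (f (w (Suc n) x / (2 * H) powr s)) * indicator (ball x0 (r (Suc n))) x)"
        by (auto simp: indicator_def ennreal_leI simp flip: ennreal_mult')
    qed
    also have "\<dots> = ennreal ((4 * z) powr s) *
        (\<integral>\<^sup>+x\<in>ball x0 (r (Suc n)). ennreal (f (w (Suc n) x / (2 * H) powr s)) \<partial>lebesgue)"
    proof (intro nn_integral_cmult borel_measurable_times_ennreal borel_measurable_indicator)
      have "(\<lambda>x. f (w (Suc n) x / (2 * H) powr s)) \<in> borel_measurable lebesgue"
        using wm w0 by (intro growth_measurable[OF g]) auto
      then show "(\<lambda>x. ennreal (f (w (Suc n) x / (2 * H) powr s))) \<in> borel_measurable lebesgue"
        by (rule measurable_compose[OF _ measurable_ennreal])
    qed (auto intro: sets_completionI_sets)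
    also have "\<dots> \<le> ennreal ((4 * z) powr s) * (ennreal (2 * 4 ^ ?d * 2 powr q / \<omega>) *
        (ennreal (c * (2 powr q + 2 * q\<^sup>2) * \<delta> powr (1 - q) * L powr q * (L / (\<tau> - \<rho>)) powr (real ?d + q)) *
         ennreal (M * \<mu> ^ n)))"
      by (intro mult_left_mono order_trans[OF FK] order_trans[OF EE] Suc.IH) auto
    also have "\<dots> = ennreal ((4 * z) powr s * (2 * 4 ^ ?d * 2 powr q / \<omega> *
        (c * (2 powr q + 2 * q\<^sup>2) * \<delta> powr (1 - q) * L powr q * (L / (\<tau> - \<rho>)) powr (real ?d + q) * (M * \<mu> ^ n))))"
      using c q \<omega> by (simp add: ennreal_mult'[symmetric])
    also have "(4 * z) powr s * (2 * 4 ^ ?d * 2 powr q / \<omega> *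
        (c * (2 powr q + 2 * q\<^sup>2) * \<delta> powr (1 - q) * L powr q * (L / (\<tau> - \<rho>)) powr (real ?d + q) * (M * \<mu> ^ n)))
      = (4 * z) powr s * (K * L powr q * (L / (\<tau> - \<rho>)) powr (real ?d + q)) * (M * \<mu> ^ n)"
      by (simp add: K_def C1 \<omega>_def mult_ac)
    also have "ennreal \<dots> \<le> ennreal (\<mu> * (M * \<mu> ^ n))"
      using fin M by (intro ennreal_leI mult_right_mono) (auto simp: \<mu>_def)
    finally show ?case by (simp add: mult_ac)
  qed
  have \<mu>1: "0 \<le> \<mu>" "\<mu> < 1"
  proof -
    have "B / \<beta> > 0" using q \<beta> by (simp add: B add_pos_pos)
    then have "2 powr (- (B / \<beta>)) < 2 powr 0" by (intro powr_less_mono) auto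
    then show "0 \<le> \<mu>" "\<mu> < 1" by (auto simp: \<mu>_def)
  qed
  define v where "v = (\<lambda>x. max (u x - \<kappa> * R powr s) 0)"
  define F where "F = (\<integral>\<^sup>+x\<in>ball x0 (\<rho> * R). ennreal (f (v x / R powr s)) \<partial>lebesgue)"
  \<comment> \<open>The limit ball lies in every ball of the sequence, and the limit level is above
    every level.\<close>
  have "F \<le> a n" for n
    unfolding F_def a_def
  proof (rule nn_integral_mono)
    fix x
    have "l n \<le> \<kappa> * R powr s * 1" unfolding l_def using k Rs by (intro mult_left_mono) auto
    then have "f (v x / R powr s) \<le> f (w n x / R powr s)"
      by (intro growth_mono[OF g] divide_right_mono) (auto simp: v_def w_def)
    moreover have "\<rho> * R \<le> r n" using R rt by (simp add: r_def distrib_left mult.commute)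
    ultimately show "ennreal (f (v x / R powr s)) * indicator (ball x0 (\<rho> * R)) x
        \<le> ennreal (f (w n x / R powr s)) * indicator (ball x0 (r n)) x"
      by (intro mult_mono ennreal_leI) (auto simp: indicator_def)
  qed
  then have "F \<le> ennreal (M * \<mu> ^ n)" for n using bound order_trans by blast
  moreover have "(\<lambda>n. ennreal (M * \<mu> ^ n)) \<longlonglongrightarrow> ennreal (M * 0)"
    using \<mu>1 by (intro tendsto_ennrealI tendsto_mult_left LIMSEQ_realpow_zero)
  ultimately have "F \<le> ennreal (M * 0)" by (intro LIMSEQ_le_const) auto
  then have F0: "F = 0" by simp
  have "(\<lambda>x. ennreal (f (v x / R powr s)) * indicator (ball x0 (\<rho> * R)) x) \<in> borel_measurable lebesgue"
  proof (intro borel_measurable_times_ennreal borel_measurable_indicator)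
    have "v \<in> borel_measurable lebesgue"
      unfolding v_def using um by (intro borel_measurable_max borel_measurable_diff) auto
    then have "(\<lambda>x. f (v x / R powr s)) \<in> borel_measurable lebesgue"
      by (intro growth_measurable[OF g]) (auto simp: v_def)
    then show "(\<lambda>x. ennreal (f (v x / R powr s))) \<in> borel_measurable lebesgue"
      by (rule measurable_compose[OF _ measurable_ennreal])
  qed (auto intro: sets_completionI_sets)
  from nn_integral_0_iff_AE[OF this] F0
  have "AE x in lebesgue. ennreal (f (v x / R powr s)) * indicator (ball x0 (\<rho> * R)) x = 0"
    by (simp add: F_def)
  then show ?thesis
  proof eventually_elim
    case (elim x)
    show ?case
    proof (intro impI leI notI)
      assume x: "x \<in> ball x0 (\<rho> * R)" and "\<kappa> * R powr s < u x"
      then have "0 < v x / R powr s" using Rs by (simp add: v_def)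
      then have "f 0 < f (v x / R powr s)" by (intro growth_strict_mono[OF g]) auto
      then have "0 < f (v x / R powr s)" using g by (simp add: growth_function_def)
      with elim x show False by simp
    qed
  qed
qed

section \<open>Choice of the level and the final constant\<close>

lemma extend_infinity_le:
  assumes g: "growth_function q f" and "0 \<le> \<kappa>" "e \<le> ennreal \<kappa>"
  shows "extend_infinity f e \<le> ennreal (f \<kappa>)"
proof -
  have "e \<noteq> \<infinity>" using assms(3) by (auto simp: top_unique)
  moreover have "enn2real e \<le> \<kappa>" using enn2real_leI[OF assms(2,3)] .
  ultimately show ?thesis
    unfolding extend_infinity_def by (auto intro!: ennreal_leI growth_mono[OF g])
qed

text \<open>For each \<open>\<epsilon> > 0\<close> the level solves \<open>f \<kappa> = \<alpha> /
  \<theta> + \<delta> * f t' + \<epsilon>\<close>, with \<open>\<alpha>\<close> the mean and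
  \<open>t'\<close> the scaled tail. The first summand yields the starting smallness, the others
  \<open>\<delta> * t \<le> \<kappa>\<close> for some \<open>t > t'\<close>. The summands of
  \<open>\<Lambda>\<close> secure \<open>small2\<close> and \<open>small1\<close>, and
  \<open>1 / \<theta>\<close> is exactly the factor in front of the mean.\<close>

lemma local_boundedness:
  fixes u :: "'a::euclidean_space \<Rightarrow> real" and s\<^sub>0 q c :: real
  defines "d \<equiv> real DIM('a)"
  defines "B \<equiv> 1 + q + (d + 2 * q)"
  defines "C1 \<equiv> 2 * 4 ^ DIM('a) * 2 powr q / unit_ball_vol d * (c * (2 powr q + 2 * q\<^sup>2))"
  defines "\<Lambda> \<equiv> 4 * 2 powr B * C1 + 2 powr (1 + q) * 8 ^ DIM('a)"
  defines "C \<equiv> (\<Lambda> * 2 powr (B * (2 * d / s\<^sub>0))) powr (2 * d / s\<^sub>0)"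
  assumes s0: "0 < s\<^sub>0" "s\<^sub>0 \<le> s" and g: "growth_function q f" and q: "1 < q" and c: "0 < c" and s: "s < 1"
    and Om: "open \<Omega>" and u: "u \<in> G_plus \<Omega> q c s f" and R: "0 < R" "ball x\<^sub>0 R \<subseteq> \<Omega>"
    and rt: "1 / 2 \<le> \<rho>" "\<rho> < \<tau>" "\<tau> \<le> 1" and \<delta>: "0 < \<delta>" "\<delta> < 1"
  defines "up \<equiv> \<lambda>x. max (u x) 0"
  shows "extend_infinity f
        (esssup (lebesgue_on (ball x\<^sub>0 (\<rho> * R))) (\<lambda>x. ennreal (up x / R powr s)))
      \<le> ennreal (C * (\<delta> powr ((1 - q) * (2 * d / s\<^sub>0)) / (\<tau> - \<rho>) powr (2 * d * (d + q) / s\<^sub>0)))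
          * ((\<integral>\<^sup>+ x \<in> ball x\<^sub>0 (\<tau> * R). ennreal (f (up x / R powr s)) \<partial>lebesgue)
             / emeasure lebesgue (ball x\<^sub>0 (\<tau> * R)))
        + ennreal \<delta> * extend_infinity f
            (nonlocal_tail s (gderiv f) up x\<^sub>0 (R / 2) / ennreal ((R / 2) powr s))"
proof -
  \<comment> \<open>Then \<open>d * \<beta>\<close> is half of \<open>s\<^sub>0\<close>, hence at
    most \<open>s\<close>, and \<open>1 / \<beta>\<close> is the exponent
    \<open>2 * d / s\<^sub>0\<close> of the theorem.\<close>
  define \<beta> where "\<beta> = s\<^sub>0 / (2 * d)"
  define \<mu> where "\<mu> = 2 powr (- (B / \<beta>))"
  define D where "D = \<tau> - \<rho>"
  define K where "K = \<delta> powr (1 - q) / D powr (d + q)"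
  define \<theta> where "\<theta> = (\<mu> / (\<Lambda> * K)) powr (1 / \<beta>)"
  define \<omega> where "\<omega> = unit_ball_vol d"
  define a where "a = (\<integral>\<^sup>+ x \<in> ball x\<^sub>0 (\<tau> * R). ennreal (f (up x / R powr s)) \<partial>lebesgue)"
  define Y where "Y = ennreal ((1 - s) * (R / 2) powr s) *
        (\<integral>\<^sup>+ y \<in> - ball x\<^sub>0 (R / 2).
           ennreal (gderiv f (max (u y) 0 / norm (y - x\<^sub>0) powr s) / norm (y - x\<^sub>0) powr (d + s)) \<partial>lebesgue)"
  define T where "T = gen_inverse (gderiv f) Y"
  have d1: "d \<ge> 1" by (simp add: d_def Suc_le_eq)
  have \<beta>: "0 < \<beta>" "d * \<beta> \<le> s" "1 / \<beta> = 2 * d / s\<^sub>0" "\<beta> \<le> 1"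
    using d1 s0 s by (auto simp: \<beta>_def field_simps)
  have D: "0 < D" "D \<le> 1" using rt by (auto simp: D_def)
  have \<omega>: "\<omega> > 0" using d1 by (simp add: \<omega>_def)
  have C1p: "C1 > 0" unfolding C1_def using c q d1 by (intro mult_pos_pos divide_pos_pos add_pos_pos) auto
  have K1: "K \<ge> 1"
  proof -
    have "1 \<le> \<delta> powr (1 - q)" using \<delta> q powr_mono'[of "1 - q" 0 \<delta>] by simp
    moreover have "D powr (d + q) \<le> 1" using D d1 q by (intro powr_le1) auto
    ultimately show ?thesis using D by (simp add: K_def field_simps)
  qed
  have L8: "2 powr (1 + q) * 8 ^ DIM('a) \<ge> 1 * (1::real)"
    using q by (intro mult_mono one_le_power ge_one_powr_ge_zero) auto
  have \<Lambda>: "\<Lambda> \<ge> 4 * 2 powr B * C1" "\<Lambda> \<ge> 2 powr (1 + q) * 8 ^ DIM('a)" "\<Lambda> \<ge> 1" "\<Lambda> > 0"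
  proof -
    have "4 * 2 powr B * C1 > 0" using C1p by simp
    with L8 show "\<Lambda> \<ge> 4 * 2 powr B * C1" "\<Lambda> \<ge> 2 powr (1 + q) * 8 ^ DIM('a)" "\<Lambda> \<ge> 1" "\<Lambda> > 0"
      unfolding \<Lambda>_def by linarith+
  qed
  have Bp: "B > 0" using q d1 by (simp add: B_def)
  have \<mu>: "0 < \<mu>" "\<mu> \<le> 1"
  proof -
    have "2 powr (- (B / \<beta>)) \<le> 2 powr 0" using Bp \<beta> by (intro powr_mono) auto
    then show "0 < \<mu>" "\<mu> \<le> 1" by (auto simp: \<mu>_def)
  qed
  have \<theta>0: "\<theta> > 0" using \<mu> \<Lambda> K1 by (simp add: \<theta>_def)
  have \<theta>b: "\<theta> powr \<beta> = \<mu> / (\<Lambda> * K)"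
    using \<mu> \<Lambda> K1 \<beta>(1) by (simp add: \<theta>_def powr_powr)
  have small1: "2 powr (1 + q) * \<theta> \<le> (1 / 8) ^ DIM('a)"
  proof -
    \<comment> \<open>The base of \<open>\<theta>\<close> is at most 1 and its exponent
      \<open>1 / \<beta>\<close> at least 1, so \<open>\<theta>\<close> is bounded by the
      base.\<close>
    have "\<mu> / (\<Lambda> * K) \<le> 1 / (\<Lambda> * 1)" using \<mu> \<Lambda> K1 by (intro frac_le mult_left_mono) auto
    then have le: "\<mu> / (\<Lambda> * K) \<le> 1 / \<Lambda>" by simp
    also have "1 / \<Lambda> \<le> 1" using \<Lambda> by simp
    finally have "\<mu> / (\<Lambda> * K) \<le> 1" .
    then have "\<theta> \<le> (\<mu> / (\<Lambda> * K)) powr 1"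
      unfolding \<theta>_def using \<mu> \<Lambda> K1 \<beta>(1,4) by (intro powr_mono') auto
    also have "\<dots> \<le> 1 / \<Lambda>" using le \<mu> \<Lambda> K1 by simp
    finally have "\<theta> \<le> 1 / \<Lambda>" .
    also have "\<dots> \<le> 1 / (2 powr (1 + q) * 8 ^ DIM('a))" using \<Lambda> by (intro divide_left_mono) auto
    finally show ?thesis by (simp add: field_simps power_divide)
  qed
  have small2: "4 * 2 powr B * (C1 * \<delta> powr (1 - q)) / D powr (d + q) * \<theta> powr \<beta> \<le> \<mu>"
  proof -
    have "4 * 2 powr B * (C1 * \<delta> powr (1 - q)) / D powr (d + q) * \<theta> powr \<beta>
      = 4 * 2 powr B * C1 * K * (\<mu> / (\<Lambda> * K))" unfolding \<theta>b by (simp add: K_def)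
    also have "\<dots> = (4 * 2 powr B * C1 / \<Lambda>) * \<mu>" using K1 by simp
    also have "\<dots> \<le> 1 * \<mu>" using \<Lambda> \<mu> by (intro mult_right_mono) auto
    finally show ?thesis by simp
  qed
  \<comment> \<open>\<open>K powr (1 / \<beta>)\<close> carries the dependence on
    \<open>\<delta>\<close> and \<open>\<tau> - \<rho>\<close>; the other factors form
    \<open>C\<close>.\<close>
  have Ceq: "C * (\<delta> powr ((1 - q) * (2 * d / s\<^sub>0)) / (\<tau> - \<rho>) powr (2 * d * (d + q) / s\<^sub>0)) = 1 / \<theta>"
  proof -
    have m: "2 powr (B * (2 * d / s\<^sub>0)) = 1 / \<mu>"
    proof -
      have "B * (2 * d / s\<^sub>0) = B / \<beta>" unfolding \<beta>(3)[symmetric] by simp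
      then show ?thesis by (simp only: \<mu>_def powr_minus_divide) simp
    qed
    have "1 / \<theta> = (1 / (\<mu> / (\<Lambda> * K))) powr (1 / \<beta>)"
      using \<mu> \<Lambda> K1 by (simp add: \<theta>_def powr_divide)
    also have "1 / (\<mu> / (\<Lambda> * K)) = \<Lambda> * (1 / \<mu>) * K" using \<mu> by simp
    also have "\<dots> powr (1 / \<beta>) = C * K powr (2 * d / s\<^sub>0)"
      unfolding C_def m \<beta>(3) using \<mu> \<Lambda> K1 by (subst powr_mult) auto
    also have "K powr (2 * d / s\<^sub>0) = \<delta> powr ((1 - q) * (2 * d / s\<^sub>0)) / D powr (2 * d * (d + q) / s\<^sub>0)"
    proof -
      have "(d + q) * (2 * d / s\<^sub>0) = 2 * d * (d + q) / s\<^sub>0" by simp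
      then show ?thesis unfolding K_def using \<delta> D by (simp only: powr_divide powr_powr powr_ge_zero)
    qed
    finally show ?thesis by (simp add: D_def)
  qed
  have Teq: "nonlocal_tail s (gderiv f) up x\<^sub>0 (R / 2) / ennreal ((R / 2) powr s) = T"
  proof -
    have "nonlocal_tail s (gderiv f) up x\<^sub>0 (R / 2) = T * ennreal ((R / 2) powr s)"
      by (simp add: nonlocal_tail_def T_def Y_def up_def d_def mult.commute)
    then show ?thesis using R by (simp add: ennreal_mult_divide_eq)
  qed
  have vol: "emeasure lebesgue (ball x\<^sub>0 (\<tau> * R)) = ennreal (\<omega> * (\<tau> * R) ^ DIM('a))"
  proof -
    have "ball x\<^sub>0 (\<tau> * R) \<in> sets lborel" by simp
    then have "emeasure lebesgue (ball x\<^sub>0 (\<tau> * R)) = emeasure lborel (ball x\<^sub>0 (\<tau> * R))"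
      by (simp only: emeasure_completion main_part sets_completionI_sets)
    then show ?thesis using emeasure_ball[of "\<tau> * R" x\<^sub>0] R rt by (simp add: \<omega>_def d_def)
  qed
  define V where "V = \<omega> * (\<tau> * R) ^ DIM('a)"
  have V: "V > 0" using \<omega> R rt by (simp add: V_def)
  let ?E = "esssup (lebesgue_on (ball x\<^sub>0 (\<rho> * R))) (\<lambda>x. ennreal (up x / R powr s))"
  have goal: "extend_infinity f ?E \<le> ennreal (1 / \<theta>) * (a / ennreal V) + ennreal \<delta> * extend_infinity f T"
  proof (cases "a / ennreal V = \<infinity> \<or> T = \<infinity>")
    \<comment> \<open>The right side is infinite, since \<open>1 / \<theta>\<close> and
      \<open>\<delta>\<close> are positive.\<close>
    case True
    then show ?thesis
      using \<theta>0 \<delta> by (auto simp: ennreal_mult_top extend_infinity_def)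
  next
    case False
    then obtain \<alpha> t' where \<alpha>: "a / ennreal V = ennreal \<alpha>" "\<alpha> \<ge> 0" and t': "T = ennreal t'" "t' \<ge> 0"
      by (cases "a / ennreal V"; cases T) auto
    have a: "a = ennreal (\<alpha> * V)"
    proof -
      have "a = a / ennreal V * ennreal V" using V by (simp add: ennreal_divide_times ennreal_mult_divide_eq)
      then show ?thesis using \<alpha> V by (simp add: ennreal_mult)
    qed
    have ft': "f t' \<ge> 0" using growth_nonneg[OF g] t' by simp
    have ext: "extend_infinity f T = ennreal (f t')" using t' by (simp add: extend_infinity_def)
    have rhs: "ennreal (1 / \<theta>) * (a / ennreal V) + ennreal \<delta> * extend_infinity f T
      = ennreal (\<alpha> / \<theta> + \<delta> * f t')"
      unfolding \<alpha>(1) ext using \<alpha>(2) \<theta>0 \<delta> ft'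
      by (simp add: ennreal_mult'[symmetric] flip: ennreal_plus)
    show ?thesis
      unfolding rhs
    proof (rule ennreal_le_epsilon)
      \<comment> \<open>The slack makes \<open>\<kappa>\<close> positive and allows
        \<open>t > t'\<close>, as the infimum in \<open>gen_inverse\<close> may fail to be
        attained.\<close>
      fix \<epsilon> :: real assume \<epsilon>: "\<epsilon> > 0"
      have \<alpha>\<theta>: "\<alpha> / \<theta> \<ge> 0" "\<delta> * f t' \<ge> 0" using \<alpha> \<theta>0 ft' \<delta> by auto
      obtain \<kappa> where \<kappa>: "\<kappa> \<ge> 0" "f \<kappa> = \<alpha> / \<theta> + \<delta> * f t' + \<epsilon>"
        using growth_surj[OF g, of "\<alpha> / \<theta> + \<delta> * f t' + \<epsilon>"] \<alpha>\<theta> \<epsilon> by auto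
      have "\<kappa> \<noteq> 0" using \<kappa> \<alpha>\<theta> \<epsilon> g by (auto simp: growth_function_def)
      with \<kappa> have \<kappa>0: "\<kappa> > 0" by simp
      obtain t where t: "t \<ge> 0" "f t = f t' + \<epsilon>"
        using growth_surj[OF g, of "f t' + \<epsilon>"] ft' \<epsilon> by auto
      have "t' < t"
      proof (rule ccontr)
        assume "\<not> t' < t"
        then have "f t \<le> f t'" by (intro growth_mono[OF g]) (use t in auto)
        with t \<epsilon> show False by simp
      qed
      \<comment> \<open>Otherwise \<open>f \<kappa> < f (\<delta> * t) \<le> \<delta> * f t \<le>
        \<delta> * f t' + \<epsilon> \<le> f \<kappa>\<close>.\<close>
      have le: "\<delta> * t \<le> \<kappa>"
      proof (rule ccontr)
        assume "\<not> \<delta> * t \<le> \<kappa>"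
        then have "f \<kappa> < f (\<delta> * t)" by (intro growth_strict_mono[OF g]) (use \<kappa> in auto)
        also have "\<dots> \<le> \<delta> * f t" using \<delta> t by (intro growth_scale_le[OF g]) auto
        also have "\<dots> \<le> \<delta> * f t' + \<epsilon>"
        proof -
          have "\<delta> * \<epsilon> \<le> 1 * \<epsilon>" using \<delta> \<epsilon> by (intro mult_right_mono) auto
          then show ?thesis using t by (simp add: distrib_left)
        qed
        finally show False using \<kappa> \<alpha>\<theta> by linarith
      qed
      \<comment> \<open>Strictly above the infimum there is an admissible \<open>t1\<close> below
        \<open>t\<close>; monotonicity of the derivative carries the bound to
        \<open>t\<close>.\<close>
      have "T < ennreal t" using t' \<open>t' < t\<close> by (simp add: ennreal_lessI)
      then obtain t1 where t1: "t1 \<ge> 0" "ennreal (gderiv f t1) \<ge> Y" "ennreal t1 < ennreal t"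
        unfolding T_def gen_inverse_def Inf_less_iff by auto
      then have "t1 \<le> t" by (simp add: ennreal_less_iff)
      then have tail: "Y \<le> ennreal (gderiv f t)"
        using t1 gderiv_mono[OF g t1(1)] by (intro order_trans[OF t1(2)] ennreal_leI)
      have start: "a \<le> ennreal (unit_ball_vol d * R ^ DIM('a) * \<theta> * f \<kappa>)"
        unfolding a
      proof (rule ennreal_leI)
        have "\<alpha> / \<theta> \<le> f \<kappa>" using \<kappa> \<alpha>\<theta> \<epsilon> by simp
        then have "\<alpha> \<le> \<theta> * f \<kappa>" using \<theta>0 by (simp add: field_simps)
        moreover have "V \<le> \<omega> * R ^ DIM('a)"
          unfolding V_def using \<omega> R rt by (intro mult_left_mono power_mono) auto
        ultimately have "\<alpha> * V \<le> (\<theta> * f \<kappa>) * (\<omega> * R ^ DIM('a))"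
          using \<alpha> V by (intro mult_mono) auto
        then show "\<alpha> * V \<le> unit_ball_vol d * R ^ DIM('a) * \<theta> * f \<kappa>"
          by (simp add: \<omega>_def mult_ac)
      qed
      have "s > 0" using s0 by simp
      have ae: "AE x in lebesgue. x \<in> ball x\<^sub>0 (\<rho> * R) \<longrightarrow> u x \<le> \<kappa> * R powr s"
        by (rule De_Giorgi_iteration[where t = t and \<delta> = \<delta> and \<beta> = \<beta> and \<theta> = \<theta> and B = B and ?C1.0 = C1,
            OF g q c \<open>s > 0\<close> s Om u R rt \<kappa>0 t(1) \<delta> le tail[unfolded Y_def d_def] \<beta>(1)
              \<beta>(2)[unfolded d_def] \<theta>0 B_def[unfolded d_def, THEN meta_eq_to_obj_eq]
              C1_def[unfolded d_def, THEN meta_eq_to_obj_eq]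
              small1 small2[unfolded D_def \<mu>_def d_def] start[unfolded a_def up_def d_def]])
      have "?E \<le> ennreal \<kappa>"
      proof (rule esssup_I)
        have "u \<in> borel_measurable lebesgue" using u by (simp add: G_plus_def V_space_def)
        then have "(\<lambda>x. up x / R powr s) \<in> borel_measurable lebesgue"
          unfolding up_def by (intro borel_measurable_divide borel_measurable_max) auto
        then have "(\<lambda>x. ennreal (up x / R powr s)) \<in> borel_measurable lebesgue"
          by (rule measurable_compose[OF _ measurable_ennreal])
        then show "(\<lambda>x. ennreal (up x / R powr s)) \<in> borel_measurable (lebesgue_on (ball x\<^sub>0 (\<rho> * R)))"
          by (rule measurable_restrict_space1)
        have "ball x\<^sub>0 (\<rho> * R) \<inter> space lebesgue \<in> sets lebesgue" by (auto intro: sets_completionI_sets)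
        then show "AE x in lebesgue_on (ball x\<^sub>0 (\<rho> * R)). ennreal (up x / R powr s) \<le> ennreal \<kappa>"
          unfolding AE_restrict_space_iff[OF \<open>ball x\<^sub>0 (\<rho> * R) \<inter> space lebesgue \<in> sets lebesgue\<close>]
          using ae
        proof eventually_elim
          case (elim x)
          then show ?case using \<kappa>0 R by (auto simp: up_def field_simps intro!: ennreal_leI)
        qed
      qed
      then have "extend_infinity f ?E \<le> ennreal (f \<kappa>)" by (rule extend_infinity_le[OF g \<kappa>(1)])
      also have "\<dots> = ennreal (\<alpha> / \<theta> + \<delta> * f t') + ennreal \<epsilon>"
        unfolding \<kappa>(2) using \<alpha>\<theta> \<epsilon> by (intro ennreal_plus) auto
      finally show "extend_infinity f ?E \<le> ennreal (\<alpha> / \<theta> + \<delta> * f t') + ennreal \<epsilon>" .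
    qed
  qed
  then show ?thesis
    unfolding Ceq Teq vol by (simp add: a_def V_def)
qed

theorem theorem3p1:
  fixes s\<^sub>0 q c :: real
  assumes "0 < s\<^sub>0" "s\<^sub>0 < 1" "1 < q" "0 < c"
  shows "\<exists>C>0. \<forall>s (\<Omega> :: (real ^ 'd) set) f u x\<^sub>0 R \<rho> \<tau> \<delta>.
    s\<^sub>0 \<le> s \<longrightarrow> s < 1 \<longrightarrow> open \<Omega> \<longrightarrow> growth_function q f \<longrightarrow> u \<in> G_plus \<Omega> q c s f \<longrightarrow>
    0 < R \<longrightarrow> ball x\<^sub>0 R \<subseteq> \<Omega> \<longrightarrow> 1 / 2 \<le> \<rho> \<longrightarrow> \<rho> < \<tau> \<longrightarrow> \<tau> \<le> 1 \<longrightarrow> 0 < \<delta> \<longrightarrow> \<delta> < 1 \<longrightarrow>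
    (let d = real CARD('d); \<gamma> = 2 * d * (d + q) / s\<^sub>0; up = (\<lambda>x. max (u x) 0) in
      extend_infinity f
        (esssup (lebesgue_on (ball x\<^sub>0 (\<rho> * R))) (\<lambda>x. ennreal (up x / R powr s)))
      \<le> ennreal (C * (\<delta> powr ((1 - q) * (2 * d / s\<^sub>0)) / (\<tau> - \<rho>) powr \<gamma>))
          * ((\<integral>\<^sup>+ x \<in> ball x\<^sub>0 (\<tau> * R). ennreal (f (up x / R powr s)) \<partial>lebesgue)
             / emeasure lebesgue (ball x\<^sub>0 (\<tau> * R)))
        + ennreal \<delta> * extend_infinity f
            (nonlocal_tail s (gderiv f) up x\<^sub>0 (R / 2) / ennreal ((R / 2) powr s)))"
proof -
  let ?n = "DIM(real ^ 'd)"
  \<comment> \<open>The constant of \<open>local_boundedness\<close> written out, to show that it is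
    fixed before \<open>s\<close>, \<open>f\<close> and \<open>u\<close>.\<close>
  define C where "C = ((4 * 2 powr (1 + q + (real ?n + 2 * q)) *
      (2 * 4 ^ ?n * 2 powr q / unit_ball_vol (real ?n) * (c * (2 powr q + 2 * q\<^sup>2)))
      + 2 powr (1 + q) * 8 ^ ?n) * 2 powr ((1 + q + (real ?n + 2 * q)) * (2 * real ?n / s\<^sub>0))) powr (2 * real ?n / s\<^sub>0)"
  have card: "?n = CARD('d)" by simp
  have "C > 0"
    unfolding C_def powr_gt_zero
    by (rule less_imp_neq[THEN not_sym],
        intro mult_pos_pos add_pos_pos divide_pos_pos unit_ball_vol_pos zero_less_power)
      (use assms in auto)
  then show ?thesis
    using local_boundedness[where 'a = "real ^ 'd" and s\<^sub>0 = s\<^sub>0 and q = q and c = c,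
        folded C_def, unfolded card] assms
    unfolding Let_def by (intro exI[of _ C] conjI allI impI) auto
qed

end
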